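(* Let $\mathscr{H}$ be a complex Hilbert space and let $A,B \in \mathbb{B}(\mathscr{H})$ be such that $A > B\geq 0$. Then: (i) for all $0 < r \leq 1$, $$A^r - B^r \geq \|A\|^r-\left(\|A\|- \frac{1}{\|(A-B)^{-1}\|}\right)^r;$$ (ii) $$\log A - \log B \geq \log\|A\| - \log\left(\|A\|-\frac{1}{\|(A-B)^{-1}\|}\right).$$
   Context: $\mathbb{B}(\mathscr{H})$ denotes the algebra of all bounded linear operators on $\mathscr{H}$ with the operator norm $\|\cdot\|$. For self-adjoint $S,T\in\mathbb{B}(\mathscr{H})$, $S\geq T$ means $\langle Sx,x\rangle\geq\langle Tx,x\rangle$ for all $x\in\mathscr{H}$, and $S>T$ means that $S\geq T$ and $S-T$ is invertible. Writing $A>B\geq 0$ includes that $A$ and $B$ are self-adjoint. Powers and the natural logarithm $\log$ are applied to operators through the functional calculus. A real scalar $c$ in an operator inequality stands for $cI$, with $I$ the identity operator. *)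

theory Defs
  imports "HOL-Analysis.Analysis" "HOL-Computational_Algebra.Polynomial"
begin

text \<open>Complex Hilbert spaces. The inner product is linear in the first argument; its positive
  definiteness follows from \<open>norm_eq_sqrt_cinner\<close> and the norm axioms.\<close>

class chilbert_space = banach +
  fixes scaleC :: "complex \<Rightarrow> 'a \<Rightarrow> 'a"  (infixr \<open>*\<^sub>C\<close> 75)
    and cinner :: "'a \<Rightarrow> 'a \<Rightarrow> complex"
  assumes scaleR_scaleC: "r *\<^sub>R x = complex_of_real r *\<^sub>C x"
    and scaleC_add_right: "a *\<^sub>C (x + y) = a *\<^sub>C x + a *\<^sub>C y"
    and scaleC_add_left: "(a + b) *\<^sub>C x = a *\<^sub>C x + b *\<^sub>C x"
    and scaleC_scaleC: "a *\<^sub>C b *\<^sub>C x = (a * b) *\<^sub>C x"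
    and scaleC_one: "1 *\<^sub>C x = x"
    and cinner_add_left: "cinner (x + y) z = cinner x z + cinner y z"
    and cinner_scaleC_left: "cinner (a *\<^sub>C x) y = a * cinner x y"
    and cinner_commute: "cinner x y = cnj (cinner y x)"
    and norm_eq_sqrt_cinner: "norm x = sqrt (Re (cinner x x))"

text \<open>The type \<open>'a \<Rightarrow>\<^sub>L 'a\<close> consists of the bounded real-linear maps with the operator norm; the
  algebra of bounded complex-linear operators is a subset of it.\<close>

definition bounded_ops :: "('a::chilbert_space \<Rightarrow>\<^sub>L 'a) set"
  where "bounded_ops = {T :: 'a \<Rightarrow>\<^sub>L 'a. \<forall>c x. T (c *\<^sub>C x) = c *\<^sub>C T x}"

definition selfadjoint :: "('a::chilbert_space \<Rightarrow>\<^sub>L 'a) \<Rightarrow> bool"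
  where "selfadjoint T \<longleftrightarrow> T \<in> bounded_ops \<and> (\<forall>x y. cinner (T x) y = cinner x (T y))"

text \<open>For a self-adjoint operator, \<open>cinner (T x) x\<close> is real.\<close>

definition op_le :: "('a::chilbert_space \<Rightarrow>\<^sub>L 'a) \<Rightarrow> ('a \<Rightarrow>\<^sub>L 'a) \<Rightarrow> bool"  (infix \<open>\<le>\<^sub>o\<^sub>p\<close> 50)
  where "T \<le>\<^sub>o\<^sub>p S \<longleftrightarrow> selfadjoint T \<and> selfadjoint S \<and>
           (\<forall>x. Re (cinner (T x) x) \<le> Re (cinner (S x) x))"

definition is_inverse_op :: "('a::chilbert_space \<Rightarrow>\<^sub>L 'a) \<Rightarrow> ('a \<Rightarrow>\<^sub>L 'a) \<Rightarrow> bool"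
  where "is_inverse_op T R \<longleftrightarrow> R \<in> bounded_ops \<and> R o\<^sub>L T = id_blinfun \<and> T o\<^sub>L R = id_blinfun"

definition invertible_op :: "('a::chilbert_space \<Rightarrow>\<^sub>L 'a) \<Rightarrow> bool"
  where "invertible_op T \<longleftrightarrow> (\<exists>R. is_inverse_op T R)"

definition inverse_op :: "('a::chilbert_space \<Rightarrow>\<^sub>L 'a) \<Rightarrow> ('a \<Rightarrow>\<^sub>L 'a)"
  where "inverse_op T = (THE R. is_inverse_op T R)"

definition op_less :: "('a::chilbert_space \<Rightarrow>\<^sub>L 'a) \<Rightarrow> ('a \<Rightarrow>\<^sub>L 'a) \<Rightarrow> bool"  (infix \<open><\<^sub>o\<^sub>p\<close> 50)
  where "T <\<^sub>o\<^sub>p S \<longleftrightarrow> T \<le>\<^sub>o\<^sub>p S \<and> invertible_op (S - T)"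

definition spectrum_op :: "('a::chilbert_space \<Rightarrow>\<^sub>L 'a) \<Rightarrow> complex set"
  where "spectrum_op T = {z. \<not> invertible_op (T - Blinfun (\<lambda>x. z *\<^sub>C x))}"

definition op_power :: "('a::chilbert_space \<Rightarrow>\<^sub>L 'a) \<Rightarrow> nat \<Rightarrow> ('a \<Rightarrow>\<^sub>L 'a)"
  where "op_power T n = ((\<lambda>S. T o\<^sub>L S) ^^ n) id_blinfun"

definition op_poly :: "real poly \<Rightarrow> ('a::chilbert_space \<Rightarrow>\<^sub>L 'a) \<Rightarrow> ('a \<Rightarrow>\<^sub>L 'a)"
  where "op_poly p T = (\<Sum>i\<le>degree p. coeff p i *\<^sub>R op_power T i)"

text \<open>The continuous functional calculus, meaningful for self-adjoint \<open>T\<close> (whose spectrum is real)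
  and \<open>f\<close> continuous on the spectrum of \<open>T\<close>: \<open>f(T)\<close> is the operator-norm limit of \<open>p\<^sub>n(T)\<close> for any
  polynomials \<open>p\<^sub>n\<close> converging to \<open>f\<close> uniformly on the spectrum.\<close>

definition fun_calc :: "(real \<Rightarrow> real) \<Rightarrow> ('a::chilbert_space \<Rightarrow>\<^sub>L 'a) \<Rightarrow> ('a \<Rightarrow>\<^sub>L 'a)"
  where "fun_calc f T = (THE S. \<forall>p :: nat \<Rightarrow> real poly.
           uniform_limit {t. complex_of_real t \<in> spectrum_op T} (\<lambda>n. poly (p n)) f sequentially
             \<longrightarrow> (\<lambda>n. op_poly (p n) T) \<longlonglongrightarrow> S)"

definition op_powr :: "('a::chilbert_space \<Rightarrow>\<^sub>L 'a) \<Rightarrow> real \<Rightarrow> ('a \<Rightarrow>\<^sub>L 'a)"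
  where "op_powr T r = fun_calc (\<lambda>t. t powr r) T"

text \<open>A bounded operator \<open>log T\<close> exists only for positive invertible \<open>T\<close>.\<close>

definition op_log :: "('a::chilbert_space \<Rightarrow>\<^sub>L 'a) \<Rightarrow> ('a \<Rightarrow>\<^sub>L 'a)"
  where "op_log T = fun_calc ln T"

text \<open>For an arbitrary \<open>T \<ge> 0\<close>, the value of \<open>\<langle>(log T) x, x\<rangle>\<close> in \<open>[-\<infinity>, \<infinity>)\<close>: the functional
  calculus is extended to \<open>log\<close>, with \<open>log 0 = -\<infinity>\<close>, as the decreasing limit of the functions
  \<open>t \<mapsto> log (max \<epsilon> t)\<close>, which are continuous on the spectrum. If \<open>T\<close> is invertible, these
  functions agree with \<open>log\<close> on the spectrum for small \<open>\<epsilon>\<close>, and the value is the finite number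
  \<open>\<langle>(op_log T) x, x\<rangle>\<close>.\<close>

definition log_form :: "('a::chilbert_space \<Rightarrow>\<^sub>L 'a) \<Rightarrow> 'a \<Rightarrow> ereal"
  where "log_form T x =
           (INF \<epsilon>\<in>{0<..}. ereal (Re (cinner (fun_calc (\<lambda>t. ln (max \<epsilon> t)) T x) x)))"

definition ln_ereal :: "real \<Rightarrow> ereal"
  where "ln_ereal t = (if t > 0 then ereal (ln t) else -\<infinity>)"

end

theory Submission
  imports Defs "HOL-Computational_Algebra.Fundamental_Theorem_Algebra"
begin

text \<open>
  Put \<open>N = \<parallel>A\<parallel>\<close> and \<open>m = 1 / \<parallel>(A - B)\<^bsup>-1\<^esup>\<parallel>\<close>. The Cauchy--Schwarz inequality for the form of the
  positive operator \<open>A - B\<close> shows \<open>A - B \<ge> m\<close> (\<open>positive_inverse_lower_bound\<close>), that is,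
  \<open>B \<le> A - m\<close>. By the Loewner--Heinz inequality, \<open>B\<^sup>r \<le> (A - m)\<^sup>r\<close>, and therefore
  \<open>A\<^sup>r - B\<^sup>r \<ge> h(A)\<close> with \<open>h(t) = t\<^sup>r - (t - m)\<^sup>r\<close>. By concavity \<open>h\<close> is decreasing, so its
  values on the spectrum of \<open>A\<close>, which lies in \<open>[m, N]\<close>, are at least \<open>h(N)\<close> (\<open>op_powr_gap\<close>).
  Division by \<open>r\<close> and the limit \<open>r \<rightarrow> 0\<close> turn powers into logarithms (\<open>log_form_gap\<close>). On the
  side of \<open>B\<close> only \<open>ln t \<le> (t\<^sup>r - 1) / r\<close> is used, which makes the limit insensitive to
  whether \<open>B\<close> is invertible; for invertible \<open>B\<close> the quadratic form of \<open>log B\<close> is dominated by the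
  extended one, so the operator inequality follows from the inequality of forms.

  The functional calculus rests on one fact: a real polynomial that is nonnegative on the real
  spectrum of a self-adjoint \<open>T\<close> has a positive value at \<open>T\<close> (\<open>op_poly_nonneg\<close>). The infimum \<open>\<mu>\<close>
  of the numerical range of \<open>p(T)\<close> is a spectral value. Over the reals \<open>p - \<mu>\<close> splits into linear
  factors and factors \<open>(t - a)\<^sup>2 + b\<^sup>2\<close> with \<open>b \<noteq> 0\<close>; the latter give coercive, hence invertible,
  operators, so a linear factor fails to be invertible and \<open>\<mu>\<close> is a value of \<open>p\<close> on the spectrum.

  The Loewner--Heinz inequality is obtained by Pedersen's method: for positive invertible
  operators the exponents for which the power is monotone form a closed set that is closed under
  midpoints (\<open>op_powr_mono_midpoint\<close>) and contains \<open>0\<close> and \<open>1\<close>; the general case follows by adding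
  a small multiple of the identity.
\<close>

section \<open>The real inner product and quadratic forms\<close>

text \<open>The order of self-adjoint operators only sees real parts. The real part of the inner product
  is a symmetric real bilinear form, for which inequalities can be stated directly.\<close>

definition rinner :: "'a::chilbert_space \<Rightarrow> 'a \<Rightarrow> real"
  where "rinner x y = Re (cinner x y)"

lemma cinner_add_right: "cinner z (x + y) = cinner z x + cinner z y"
  by (simp only: cinner_commute[of z] cinner_add_left complex_cnj_add)

lemma cinner_scaleC_right: "cinner x (a *\<^sub>C y) = cnj a * cinner x y"
  by (simp only: cinner_commute[of x] cinner_scaleC_left complex_cnj_mult)

lemma cinner_scaleR_left: "cinner (r *\<^sub>R x) y = of_real r * cinner x y"
  by (simp add: scaleR_scaleC cinner_scaleC_left)

lemma cinner_scaleR_right: "cinner x (r *\<^sub>R y) = of_real r * cinner x y"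
  by (simp add: scaleR_scaleC cinner_scaleC_right)

lemma rinner_add_left: "rinner (x + y) z = rinner x z + rinner y z"
  by (simp add: rinner_def cinner_add_left)

lemma rinner_commute: "rinner x y = rinner y x"
  unfolding rinner_def by (subst cinner_commute) simp

lemma rinner_add_right: "rinner z (x + y) = rinner z x + rinner z y"
  by (simp only: rinner_commute[of z] rinner_add_left)

lemma rinner_scaleR_left: "rinner (r *\<^sub>R x) y = r * rinner x y"
  by (simp add: rinner_def cinner_scaleR_left)

lemma rinner_scaleR_right: "rinner x (r *\<^sub>R y) = r * rinner x y"
  by (simp add: rinner_def cinner_scaleR_right)

lemma rinner_self: "rinner x x = (norm x)\<^sup>2"
proof -
  have "0 \<le> Re (cinner x x)"
    by (metis norm_eq_sqrt_cinner norm_ge_zero real_sqrt_ge_0_iff)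
  then show ?thesis
    by (simp add: rinner_def norm_eq_sqrt_cinner)
qed

lemma selfadjoint_rinner: "selfadjoint T \<Longrightarrow> rinner (T x) y = rinner x (T y)"
  by (simp add: selfadjoint_def rinner_def)

lemma nonneg_quadratic_discriminant:
  fixes a b c :: real
  assumes "\<And>t. 0 \<le> a + 2 * t * b + t\<^sup>2 * c"
  shows "b\<^sup>2 \<le> a * c"
proof (cases "c = 0")
  case True
  have "b = 0"
  proof (rule ccontr)
    assume "b \<noteq> 0"
    then show False
      using assms[of "-(a + 1) / (2 * b)"] True by (simp add: field_simps)
  qed
  then show ?thesis by (simp add: True)
next
  case False
  have "0 \<le> c"
  proof (rule ccontr)
    assume "\<not> 0 \<le> c"
    then have c: "c < 0" by simp
    \<comment> \<open>The parabola opens downwards, so some value is negative.\<close>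
    define t where "t = (\<bar>a\<bar> + 2 * \<bar>b\<bar> + 1) / (- c) + 1"
    have t1: "1 \<le> t" using c by (simp add: t_def divide_nonneg_neg)
    have "t * (- c) = \<bar>a\<bar> + 2 * \<bar>b\<bar> + 1 - c"
      using c by (simp add: t_def field_simps)
    then have tc: "t * c = - (\<bar>a\<bar> + 2 * \<bar>b\<bar> + 1 - c)" by simp
    have "a + 2 * t * b + t\<^sup>2 * c = a + t * (2 * b + t * c)"
      by (simp add: power2_eq_square algebra_simps)
    also have "\<dots> = a + t * (2 * b - (\<bar>a\<bar> + 2 * \<bar>b\<bar> + 1 - c))"
      by (simp only: tc) simp
    also have "\<dots> \<le> a + t * (- \<bar>a\<bar> - 1)"
      using t1 c by (intro add_left_mono mult_left_mono) auto
    also have "\<dots> \<le> a + 1 * (- \<bar>a\<bar> - 1)"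
      using t1 by (intro add_left_mono mult_right_mono_neg) auto
    also have "\<dots> < 0" by simp
    finally show False using assms[of t] by simp
  qed
  with False have "0 < c" by simp
  then show ?thesis
    using assms[of "- b / c"] by (simp add: field_simps power2_eq_square)
qed

text \<open>The Cauchy--Schwarz inequality for the semi-inner product \<open>\<langle>S x, y\<rangle>\<close> of a positive
  operator; it turns information on the form \<open>\<langle>S x, x\<rangle>\<close> into information on \<open>S x\<close>.\<close>

lemma form_Cauchy_Schwarz:
  assumes "selfadjoint S" and pos: "\<And>x. 0 \<le> rinner (S x) x"
  shows "(rinner (S x) y)\<^sup>2 \<le> rinner (S x) x * rinner (S y) y"
proof (rule nonneg_quadratic_discriminant)
  fix t
  have "rinner (S (x + t *\<^sub>R y)) (x + t *\<^sub>R y)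
      = rinner (S x) x + 2 * t * rinner (S x) y + t\<^sup>2 * rinner (S y) y"
    using selfadjoint_rinner[OF assms(1), of y x] rinner_commute[of y "S x"]
    by (simp add: blinfun.add_right blinfun.scaleR_right rinner_add_left rinner_add_right
        rinner_scaleR_left rinner_scaleR_right power2_eq_square algebra_simps)
  then show "0 \<le> rinner (S x) x + 2 * t * rinner (S x) y + t\<^sup>2 * rinner (S y) y"
    using pos[of "x + t *\<^sub>R y"] by (simp only:)
qed

lemma rinner_Cauchy_Schwarz: "\<bar>rinner x y\<bar> \<le> norm x * norm y"
proof -
  have "(rinner x y)\<^sup>2 \<le> rinner x x * rinner y y"
  proof (rule nonneg_quadratic_discriminant)
    fix t
    have "0 \<le> rinner (x + t *\<^sub>R y) (x + t *\<^sub>R y)" by (simp add: rinner_self)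
    also have "\<dots> = rinner x x + 2 * t * rinner x y + t\<^sup>2 * rinner y y"
      by (simp add: rinner_add_left rinner_add_right rinner_commute[of y x]
          rinner_scaleR_left rinner_scaleR_right power2_eq_square algebra_simps)
    finally show "0 \<le> rinner x x + 2 * t * rinner x y + t\<^sup>2 * rinner y y" .
  qed
  then have "\<bar>rinner x y\<bar>\<^sup>2 \<le> (norm x * norm y)\<^sup>2"
    by (simp add: rinner_self power_mult_distrib)
  then show ?thesis by (rule power2_le_imp_le) simp
qed

lemma bounded_bilinear_rinner: "bounded_bilinear rinner"
proof
  show "\<exists>K. \<forall>x y. norm (rinner x y) \<le> norm x * norm y * K"
    by (rule exI[of _ 1]) (simp add: rinner_Cauchy_Schwarz)
qed (simp_all add: rinner_add_left rinner_add_right rinner_scaleR_left rinner_scaleR_right)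

lemmas rinner_diff_left = bounded_bilinear.diff_left[OF bounded_bilinear_rinner]
lemmas rinner_diff_right = bounded_bilinear.diff_right[OF bounded_bilinear_rinner]
lemmas rinner_minus_left = bounded_bilinear.minus_left[OF bounded_bilinear_rinner]
lemmas rinner_zero_left = bounded_bilinear.zero_left[OF bounded_bilinear_rinner]
lemmas rinner_zero_right = bounded_bilinear.zero_right[OF bounded_bilinear_rinner]
lemmas tendsto_rinner = bounded_bilinear.tendsto[OF bounded_bilinear_rinner]

lemmas rinner_simps = rinner_add_left rinner_add_right rinner_scaleR_left rinner_scaleR_right
  rinner_diff_left rinner_diff_right rinner_minus_left rinner_zero_left rinner_zero_right rinner_self
  blinfun.add_left blinfun.diff_left blinfun.scaleR_left blinfun.minus_left
  blinfun.add_right blinfun.diff_right blinfun.scaleR_right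

lemma abs_form_le_norm: "\<bar>rinner (T x) x\<bar> \<le> norm T * (norm x)\<^sup>2"
  for T :: "'a::chilbert_space \<Rightarrow>\<^sub>L 'a"
proof -
  have "\<bar>rinner (T x) x\<bar> \<le> norm (T x) * norm x" by (rule rinner_Cauchy_Schwarz)
  also have "\<dots> \<le> (norm T * norm x) * norm x"
    by (intro mult_right_mono norm_blinfun) auto
  finally show ?thesis by (simp add: power2_eq_square algebra_simps)
qed

text \<open>For a positive operator the upper bound of the quadratic form is a bound of the norm, and
  vectors on which the form is small are nearly annihilated.\<close>

lemma norm_sq_le_form:
  assumes S: "selfadjoint S" and pos: "\<And>x. 0 \<le> rinner (S x) x"
    and ub: "\<And>x. rinner (S x) x \<le> k * (norm x)\<^sup>2"
  shows "(norm (S x))\<^sup>2 \<le> k * rinner (S x) x"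
proof (cases "S x = 0")
  case True
  then show ?thesis by (simp add: rinner_zero_left)
next
  case False
  have "((norm (S x))\<^sup>2)\<^sup>2 = (rinner (S x) (S x))\<^sup>2" by (simp add: rinner_self)
  also have "\<dots> \<le> rinner (S x) x * rinner (S (S x)) (S x)"
    by (rule form_Cauchy_Schwarz[OF S pos])
  also have "\<dots> \<le> rinner (S x) x * (k * (norm (S x))\<^sup>2)"
    by (intro mult_left_mono ub pos)
  finally have "(norm (S x))\<^sup>2 * (norm (S x))\<^sup>2 \<le> (k * rinner (S x) x) * (norm (S x))\<^sup>2"
    by (simp add: power2_eq_square mult_ac)
  then show ?thesis by (rule mult_right_le_imp_le) (use False in simp)
qed

lemma norm_le_form_bound:
  assumes S: "selfadjoint S" and pos: "\<And>x. 0 \<le> rinner (S x) x"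
    and ub: "\<And>x. rinner (S x) x \<le> k * (norm x)\<^sup>2" and k: "0 \<le> k"
  shows "norm (S x) \<le> k * norm x"
proof -
  have "(norm (S x))\<^sup>2 \<le> k * rinner (S x) x" by (rule norm_sq_le_form[OF S pos ub])
  also have "\<dots> \<le> k * (k * (norm x)\<^sup>2)" by (intro mult_left_mono ub k)
  finally have "(norm (S x))\<^sup>2 \<le> (k * norm x)\<^sup>2" by (simp add: power2_eq_square mult_ac)
  then show ?thesis by (rule power2_le_imp_le) (simp add: k)
qed

section \<open>The algebra of self-adjoint operators\<close>

lemma scaleC_scaleR: "c *\<^sub>C (r *\<^sub>R x) = r *\<^sub>R (c *\<^sub>C (x::'a::chilbert_space))"
  by (simp add: scaleR_scaleC scaleC_scaleC mult.commute)

lemma bounded_linear_scaleC: "bounded_linear (\<lambda>x::'a::chilbert_space. c *\<^sub>C x)"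
proof
  show "\<exists>K. \<forall>x::'a. norm (c *\<^sub>C x) \<le> norm x * K"
  proof (intro exI allI)
    fix x :: 'a
    have "cinner (c *\<^sub>C x) (c *\<^sub>C x) = of_real ((norm c)\<^sup>2) * cinner x x"
      by (simp add: cinner_scaleC_left cinner_scaleC_right complex_norm_square mult_ac
          del: of_real_power)
    then have "(norm (c *\<^sub>C x))\<^sup>2 = (norm c * norm x)\<^sup>2"
      using rinner_self[of "c *\<^sub>C x"] rinner_self[of x] by (simp add: rinner_def power_mult_distrib)
    then show "norm (c *\<^sub>C x) \<le> norm x * norm c"
      by (simp add: mult.commute)
  qed
qed (simp_all add: scaleC_add_right scaleC_scaleR)

lemma selfadjoint_id: "selfadjoint (id_blinfun :: 'a::chilbert_space \<Rightarrow>\<^sub>L 'a)"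
  by (simp add: selfadjoint_def bounded_ops_def)

lemma selfadjoint_add: "selfadjoint S \<Longrightarrow> selfadjoint T \<Longrightarrow> selfadjoint (S + T)"
  by (simp add: selfadjoint_def bounded_ops_def blinfun.add_left scaleC_add_right
      cinner_add_left cinner_add_right)

lemma selfadjoint_scaleR: "selfadjoint T \<Longrightarrow> selfadjoint (r *\<^sub>R T)"
  by (simp add: selfadjoint_def bounded_ops_def blinfun.scaleR_left scaleC_scaleR
      cinner_scaleR_left cinner_scaleR_right)

lemma selfadjoint_diff: "selfadjoint S \<Longrightarrow> selfadjoint T \<Longrightarrow> selfadjoint (S - T)"
  using selfadjoint_add[of S "(-1) *\<^sub>R T"] selfadjoint_scaleR[of T "-1"] by simp

lemma selfadjoint_zero: "selfadjoint (0 :: 'a::chilbert_space \<Rightarrow>\<^sub>L 'a)"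
  using selfadjoint_scaleR[OF selfadjoint_id, of 0] by (simp only: scaleR_zero_left)

lemma selfadjoint_compose:
  assumes S: "selfadjoint S" and T: "selfadjoint T" and comm: "S o\<^sub>L T = T o\<^sub>L S"
  shows "selfadjoint (S o\<^sub>L T)"
proof -
  have c: "T (S y) = S (T y)" for y
    using arg_cong[OF comm, of "\<lambda>f. blinfun_apply f y"] by simp
  have "cinner (S (T x)) y = cinner x (S (T y))" for x y
  proof -
    have "cinner (S (T x)) y = cinner (T x) (S y)" using S unfolding selfadjoint_def by blast
    also have "\<dots> = cinner x (T (S y))" using T unfolding selfadjoint_def by blast
    finally show ?thesis unfolding c .
  qed
  then show ?thesis using S T unfolding selfadjoint_def bounded_ops_def by simp
qed

lemma tendsto_cinner_left:
  assumes "X \<longlonglongrightarrow> x" shows "(\<lambda>n. cinner (X n) y) \<longlonglongrightarrow> cinner x (y::'a::chilbert_space)"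
proof -
  have im: "Im (cinner u v) = rinner u (\<i> *\<^sub>C v)" for u v :: 'a
    by (simp add: rinner_def cinner_scaleC_right)
  show ?thesis
    unfolding tendsto_complex_iff im rinner_def[symmetric]
    by (rule conjI; rule tendsto_rinner[OF assms tendsto_const])
qed

lemma selfadjoint_LIMSEQ:
  fixes T :: "'a::chilbert_space \<Rightarrow>\<^sub>L 'a"
  assumes F: "\<And>n. selfadjoint (F n)" and lim: "F \<longlonglongrightarrow> T"
  shows "selfadjoint T"
proof -
  have pt: "(\<lambda>n. F n x) \<longlonglongrightarrow> T x" for x
    by (rule blinfun.tendsto[OF lim tendsto_const])
  have lin: "F n (c *\<^sub>C x) = c *\<^sub>C F n x" for n c x
    using F[of n] by (simp only: selfadjoint_def bounded_ops_def mem_Collect_eq)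
  have sym: "cinner (F n x) y = cnj (cinner (F n y) x)" for n x y
  proof -
    have "cinner (F n x) y = cinner x (F n y)" using F[of n] unfolding selfadjoint_def by blast
    also have "\<dots> = cnj (cinner (F n y) x)" by (rule cinner_commute)
    finally show ?thesis .
  qed
  have "T (c *\<^sub>C x) = c *\<^sub>C T x" for c x
  proof (rule LIMSEQ_unique)
    show "(\<lambda>n. F n (c *\<^sub>C x)) \<longlonglongrightarrow> T (c *\<^sub>C x)" by (rule pt)
    show "(\<lambda>n. F n (c *\<^sub>C x)) \<longlonglongrightarrow> c *\<^sub>C T x"
      unfolding lin by (rule bounded_linear.tendsto[OF bounded_linear_scaleC pt])
  qed
  moreover have "cinner (T x) y = cinner x (T y)" for x y
  proof (rule LIMSEQ_unique)
    show "(\<lambda>n. cinner (F n x) y) \<longlonglongrightarrow> cinner (T x) y"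
      by (rule tendsto_cinner_left[OF pt])
    have "(\<lambda>n. cnj (cinner (F n y) x)) \<longlonglongrightarrow> cnj (cinner (T y) x)"
      by (rule tendsto_cnj[OF tendsto_cinner_left[OF pt]])
    then show "(\<lambda>n. cinner (F n x) y) \<longlonglongrightarrow> cinner x (T y)"
      unfolding sym[of _ x y] cinner_commute[of x "T y"] .
  qed
  ultimately show ?thesis unfolding selfadjoint_def bounded_ops_def by blast
qed

section \<open>Invertibility\<close>

lemma is_inverse_op_unique: "is_inverse_op T R \<Longrightarrow> is_inverse_op T R' \<Longrightarrow> R = R'"
  unfolding is_inverse_op_def
  by (metis blinfun_apply_blinfun_compose blinfun_apply_id_blinfun blinfun_eqI)

lemma is_inverse_op_inverse_op: "invertible_op T \<Longrightarrow> is_inverse_op T (inverse_op T)"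
  unfolding invertible_op_def inverse_op_def
  by (metis (mono_tags, lifting) is_inverse_op_unique theI)

lemma invertible_op_compose:
  assumes "invertible_op S" "invertible_op T" shows "invertible_op (S o\<^sub>L T)"
proof -
  obtain P Q where P: "is_inverse_op S P" and Q: "is_inverse_op T Q"
    using assms by (auto simp: invertible_op_def)
  have p: "P (S x) = x" "S (P x) = x" "T (Q x) = x" "Q (T x) = x" for x
    using P Q by (auto simp: is_inverse_op_def dest: arg_cong[where f="\<lambda>f. blinfun_apply f x"])
  have "is_inverse_op (S o\<^sub>L T) (Q o\<^sub>L P)"
    using P Q p by (auto simp: is_inverse_op_def bounded_ops_def intro!: blinfun_eqI)
  then show ?thesis by (auto simp: invertible_op_def)
qed

lemma invertible_op_scaleR_id:
  assumes "c \<noteq> 0" shows "invertible_op (c *\<^sub>R (id_blinfun :: 'a::chilbert_space \<Rightarrow>\<^sub>L 'a))"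
proof -
  have "is_inverse_op (c *\<^sub>R (id_blinfun :: 'a \<Rightarrow>\<^sub>L 'a)) (inverse c *\<^sub>R id_blinfun)"
    using assms by (auto simp: is_inverse_op_def bounded_ops_def blinfun.scaleR_left scaleC_scaleR
        intro!: blinfun_eqI)
  then show ?thesis by (auto simp: invertible_op_def)
qed

text \<open>A positive operator whose form is bounded below is invertible: after rescaling, \<open>I - T / M\<close>
  is a strict contraction, so \<open>T x = y\<close> is a fixed point equation for a contraction.\<close>

lemma coercive_imp_invertible_op:
  fixes T :: "'a::chilbert_space \<Rightarrow>\<^sub>L 'a"
  assumes T: "selfadjoint T" and c: "0 < c" and lb: "\<And>x. c * (norm x)\<^sup>2 \<le> rinner (T x) x"
  shows "invertible_op T"
proof -
  \<comment> \<open>Adding \<open>c\<close> keeps \<open>M\<close> positive and gives the contraction constant \<open>1 - c / M\<close> in \<open>[0, 1)\<close>.\<close>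
  define M where "M = norm T + c"
  have M: "0 < M" using c by (simp add: M_def add_nonneg_pos)
  define S where "S = id_blinfun - (1 / M) *\<^sub>R T"
  have Sx: "S x = x - (1 / M) *\<^sub>R T x" for x
    by (simp add: S_def blinfun.diff_left blinfun.scaleR_left)
  have S: "selfadjoint S"
    unfolding S_def by (intro selfadjoint_diff selfadjoint_id selfadjoint_scaleR T)
  define k where "k = 1 - c / M"
  have k: "0 \<le> k" "k < 1" using c M by (auto simp: k_def M_def field_simps)
  have form: "rinner (S x) x = (norm x)\<^sup>2 - rinner (T x) x / M" for x
    by (simp add: Sx rinner_simps)
  have contr: "norm (S x) \<le> k * norm x" for x
  proof (rule norm_le_form_bound[OF S _ _ k(1)])
    fix x
    have "rinner (T x) x \<le> norm T * (norm x)\<^sup>2" using abs_form_le_norm[of T x] by simp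
    also have "\<dots> \<le> M * (norm x)\<^sup>2" using c by (intro mult_right_mono) (auto simp: M_def)
    finally show "0 \<le> rinner (S x) x" using M by (simp add: form field_simps)
    show "rinner (S x) x \<le> k * (norm x)\<^sup>2"
      using lb[of x] M by (simp add: form k_def field_simps)
  qed
  have surj: "\<exists>x. T x = y" for y
  proof -
    have "\<exists>!x. S x + (1 / M) *\<^sub>R y = x"
    proof (rule banach_fix_type[OF k], intro allI)
      fix u v
      show "dist (S u + (1 / M) *\<^sub>R y) (S v + (1 / M) *\<^sub>R y) \<le> k * dist u v"
        using contr[of "u - v"] by (simp add: dist_norm blinfun.diff_right)
    qed
    then obtain x where "S x + (1 / M) *\<^sub>R y = x" by blast
    then have "(1 / M) *\<^sub>R (y - T x) = 0" by (simp add: Sx algebra_simps)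
    then show ?thesis using M by auto
  qed
  have below: "c * norm x \<le> norm (T x)" for x
  proof (cases "x = 0")
    case False
    have "c * (norm x)\<^sup>2 \<le> norm (T x) * norm x"
      using lb[of x] rinner_Cauchy_Schwarz[of "T x" x] by linarith
    then have "(c * norm x) * norm x \<le> norm (T x) * norm x" by (simp add: power2_eq_square)
    then show ?thesis by (rule mult_right_le_imp_le) (use False in simp)
  qed simp
  have inj: "x = y" if "T x = T y" for x y
    using below[of "x - y"] that c by (simp add: blinfun.diff_right mult_le_0_iff)
  define R where "R = (\<lambda>y. SOME x. T x = y)"
  have TR: "T (R y) = y" for y
    unfolding R_def using surj by (rule someI_ex)
  have RT: "R (T x) = x" for x by (rule inj) (rule TR)
  have "bounded_linear R"
  proof
    show "R (x + y) = R x + R y" for x y by (rule inj) (simp add: TR blinfun.add_right)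
    show "R (r *\<^sub>R x) = r *\<^sub>R R x" for r x by (rule inj) (simp add: TR blinfun.scaleR_right)
    show "\<exists>K. \<forall>x. norm (R x) \<le> norm x * K"
    proof (intro exI[of _ "1 / c"] allI)
      show "norm (R x) \<le> norm x * (1 / c)" for x
        using below[of "R x"] c by (simp add: TR field_simps)
    qed
  qed
  then have B: "blinfun_apply (Blinfun R) = R" by (rule bounded_linear_Blinfun_apply)
  have "R (a *\<^sub>C x) = a *\<^sub>C R x" for a x
    by (rule inj) (use T in \<open>simp add: TR selfadjoint_def bounded_ops_def\<close>)
  then have "is_inverse_op T (Blinfun R)"
    by (auto simp: is_inverse_op_def bounded_ops_def B TR RT intro!: blinfun_eqI)
  then show ?thesis by (auto simp: invertible_op_def)
qed

text \<open>The optimal constant in the converse is the reciprocal of the norm of the inverse: apply the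
  Cauchy--Schwarz inequality of the form to \<open>\<parallel>x\<parallel>\<^sup>2 = \<langle>D (R x), x\<rangle>\<close>.\<close>

lemma positive_inverse_lower_bound:
  fixes D :: "'a::chilbert_space \<Rightarrow>\<^sub>L 'a"
  assumes D: "selfadjoint D" and pos: "\<And>x. 0 \<le> rinner (D x) x" and R: "is_inverse_op D R"
  shows "(norm x)\<^sup>2 / norm R \<le> rinner (D x) x"
proof (cases "x = 0")
  case False
  have DR: "D (R y) = y" for y
    using R by (auto simp: is_inverse_op_def dest: arg_cong[where f="\<lambda>f. blinfun_apply f y"])
  have "((norm x)\<^sup>2)\<^sup>2 = (rinner (D (R x)) x)\<^sup>2" by (simp add: DR rinner_self)
  also have "\<dots> \<le> rinner (D (R x)) (R x) * rinner (D x) x"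
    by (rule form_Cauchy_Schwarz[OF D pos])
  also have "\<dots> \<le> (norm R * (norm x)\<^sup>2) * rinner (D x) x"
    using abs_form_le_norm[of R x] by (intro mult_right_mono pos) (simp add: DR rinner_commute)
  finally have "(norm x)\<^sup>2 * (norm x)\<^sup>2 \<le> (norm R * rinner (D x) x) * (norm x)\<^sup>2"
    by (simp add: power2_eq_square mult_ac)
  then have le: "(norm x)\<^sup>2 \<le> norm R * rinner (D x) x"
    by (rule mult_right_le_imp_le) (use False in simp)
  then have "norm R \<noteq> 0" using False by auto
  then have "0 < norm R" by simp
  with le show ?thesis by (simp only: pos_divide_le_eq mult.commute)
qed (simp add: rinner_zero_right)

section \<open>Polynomials of a self-adjoint operator\<close>

lemma op_power_0: "op_power T 0 = id_blinfun"
  by (simp add: op_power_def)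

lemma op_power_Suc: "op_power T (Suc n) = T o\<^sub>L op_power T n"
  by (simp add: op_power_def)

lemma op_poly_altdef:
  assumes "degree p \<le> n" shows "op_poly p T = (\<Sum>i\<le>n. coeff p i *\<^sub>R op_power T i)"
  unfolding op_poly_def by (rule sum.mono_neutral_left) (use assms in \<open>auto simp: coeff_eq_0\<close>)

lemma op_poly_0: "op_poly 0 T = 0"
  by (simp add: op_poly_def)

lemma op_poly_add: "op_poly (p + q) T = op_poly p T + op_poly q T"
proof -
  have "degree (p + q) \<le> max (degree p) (degree q)" by (rule degree_add_le_max)
  then show ?thesis
    by (simp add: op_poly_altdef[of _ "max (degree p) (degree q)"] scaleR_add_left sum.distrib)
qed

lemma op_poly_smult: "op_poly (smult c p) T = c *\<^sub>R op_poly p T"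
  by (simp add: op_poly_altdef[of _ "degree p"] scaleR_sum_right)

lemma op_poly_pCons: "op_poly (pCons a p) T = a *\<^sub>R id_blinfun + (T o\<^sub>L op_poly p T)"
proof -
  have "op_poly (pCons a p) T = (\<Sum>i\<le>Suc (degree p). coeff (pCons a p) i *\<^sub>R op_power T i)"
    by (rule op_poly_altdef) (simp add: degree_pCons_le)
  also have "\<dots> = a *\<^sub>R id_blinfun + (\<Sum>i\<le>degree p. coeff p i *\<^sub>R (T o\<^sub>L op_power T i))"
    by (simp add: sum.atMost_Suc_shift op_power_0 op_power_Suc del: sum.atMost_Suc)
  also have "(\<Sum>i\<le>degree p. coeff p i *\<^sub>R (T o\<^sub>L op_power T i)) = T o\<^sub>L op_poly p T"
    unfolding op_poly_def
    by (simp add: bounded_bilinear.sum_right[OF bounded_bilinear_blinfun_compose]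
        bounded_bilinear.scaleR_right[OF bounded_bilinear_blinfun_compose])
  finally show ?thesis .
qed

lemma op_poly_pCons_apply: "op_poly (pCons a p) T x = a *\<^sub>R x + T (op_poly p T x)"
  by (simp add: op_poly_pCons blinfun.add_left blinfun.scaleR_left)

lemma op_poly_const: "op_poly [:c:] T = c *\<^sub>R id_blinfun"
  by (rule blinfun_eqI)
     (simp add: op_poly_pCons_apply op_poly_0 blinfun.scaleR_left)

lemma op_poly_linear: "op_poly [:c, 1:] T = T + c *\<^sub>R id_blinfun"
  by (rule blinfun_eqI)
     (simp add: op_poly_pCons_apply op_poly_0 blinfun.scaleR_left blinfun.add_left)

lemma op_poly_diff: "op_poly (p - q) T = op_poly p T - op_poly q T"
  using op_poly_add[of p "smult (-1) q" T] op_poly_smult[of "-1" q T] by simp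

lemma op_poly_mult: "op_poly (p * q) T = op_poly p T o\<^sub>L op_poly q T"
proof (induction p)
  case 0
  show ?case by (simp add: op_poly_0)
next
  case (pCons a p)
  show ?case
    by (rule blinfun_eqI)
       (simp add: op_poly_add op_poly_smult op_poly_pCons_apply pCons.IH blinfun.add_left
         blinfun.scaleR_left blinfun_eqI)
qed

lemma op_poly_pcompose: "op_poly (pcompose p q) T = op_poly p (op_poly q T)"
proof (induction p)
  case 0
  show ?case by (simp add: op_poly_0)
next
  case (pCons a p)
  show ?case
    by (simp add: pcompose_pCons op_poly_add op_poly_mult op_poly_const op_poly_pCons[of a p] pCons.IH)
qed

lemma selfadjoint_op_poly:
  assumes "selfadjoint T" shows "selfadjoint (op_poly p T)"
proof (induction p)
  case 0
  show ?case by (simp add: op_poly_0 selfadjoint_zero)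
next
  case (pCons a p)
  have "T o\<^sub>L op_poly p T = op_poly p T o\<^sub>L T"
    using op_poly_mult[of "[:0, 1:]" p T] op_poly_mult[of p "[:0, 1:]" T]
    by (simp add: op_poly_linear mult.commute)
  then show ?case
    unfolding op_poly_pCons
    by (intro selfadjoint_add selfadjoint_scaleR selfadjoint_id selfadjoint_compose assms pCons.IH)
qed

section \<open>The real spectrum\<close>

definition real_spectrum :: "('a::chilbert_space \<Rightarrow>\<^sub>L 'a) \<Rightarrow> real set"
  where "real_spectrum T = {t. complex_of_real t \<in> spectrum_op T}"

lemma real_spectrum_iff:
  fixes T :: "'a::chilbert_space \<Rightarrow>\<^sub>L 'a"
  shows "t \<in> real_spectrum T \<longleftrightarrow> \<not> invertible_op (T - t *\<^sub>R id_blinfun)"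
proof -
  have "Blinfun (\<lambda>x::'a. complex_of_real t *\<^sub>C x) = t *\<^sub>R id_blinfun"
    by (rule blinfun_eqI)
       (simp add: bounded_linear_Blinfun_apply bounded_linear_scaleC blinfun.scaleR_left scaleR_scaleC)
  then show ?thesis by (simp add: real_spectrum_def spectrum_op_def)
qed

lemma poly_map_of_real_of_real:
  "poly (map_poly of_real p) (of_real x) = (of_real (poly p x) :: complex)"
  by (induction p) (simp_all add: map_poly_pCons)

lemma poly_map_of_real_add:
  "poly (map_poly of_real (p + q)) (z::complex)
    = poly (map_poly of_real p) z + poly (map_poly of_real q) z"
proof -
  have "map_poly of_real (p + q) = (map_poly of_real p + map_poly of_real q :: complex poly)"
    by (rule poly_eqI) (simp add: coeff_map_poly)
  then show ?thesis by simp
qed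

lemma poly_map_of_real_mult:
  "poly (map_poly of_real (p * q)) (z::complex)
    = poly (map_poly of_real p) z * poly (map_poly of_real q) z"
proof (induction p)
  case 0
  show ?case by simp
next
  case (pCons a p)
  have "map_poly of_real (smult a q) = (smult (of_real a) (map_poly of_real q) :: complex poly)"
    by (rule poly_eqI) (simp add: coeff_map_poly)
  then show ?case
    by (simp add: poly_map_of_real_add map_poly_pCons pCons.IH algebra_simps)
qed

text \<open>A complex root yields either the linear factor of a real root or the quadratic factor
  of a conjugate pair \<open>a \<plusminus> \<i> b\<close>, in the form \<open>(t - a)\<^sup>2 + b\<^sup>2\<close>.\<close>

lemma real_poly_factor:
  fixes q :: "real poly"
  assumes "0 < degree q"
  obtains (linear) r s where "q = [:- r, 1:] * s"
  | (quadratic) a b s where "b \<noteq> 0" "q = ([:- a, 1:] * [:- a, 1:] + [:b\<^sup>2:]) * s"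
proof -
  have "degree (map_poly complex_of_real q) = degree q"
    by (rule degree_map_poly) auto
  then obtain z where z: "poly (map_poly complex_of_real q) z = 0"
    using assms fundamental_theorem_of_algebra[of "map_poly complex_of_real q"]
    by (metis constant_degree less_irrefl)
  show ?thesis
  proof (cases "Im z = 0")
    case True
    then have "z = of_real (Re z)" by (simp add: complex_eq_iff)
    then have "of_real (poly q (Re z)) = (0::complex)"
      using z poly_map_of_real_of_real[of q "Re z"] by metis
    then have "[:- Re z, 1:] dvd q" by (simp add: poly_eq_0_iff_dvd)
    then show ?thesis using linear by (auto simp: dvd_def)
  next
    case False
    define a b where "a = Re z" and "b = Im z"
    define d where "d = [:- a, 1:] * [:- a, 1:] + [:b\<^sup>2:]"
    have d: "d = [:a\<^sup>2 + b\<^sup>2, - 2 * a, 1:]" by (simp add: d_def power2_eq_square)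
    have dz: "poly (map_poly complex_of_real d) z = 0"
      by (simp add: d map_poly_pCons complex_eq_iff a_def b_def power2_eq_square algebra_simps)
    have "degree (q mod d) < 2"
      using degree_mod_less[of d q] by (auto simp: d)
    then have "q mod d = [:coeff (q mod d) 0, coeff (q mod d) 1:]"
      by (intro poly_eqI) (auto simp: coeff_pCons coeff_eq_0 split: nat.split)
    then obtain u v where uv: "q mod d = [:u, v:]" by blast
    have "poly (map_poly complex_of_real (q div d * d + q mod d)) z = 0"
      by (simp only: div_mult_mod_eq z)
    then have "of_real u + z * of_real v = 0"
      unfolding poly_map_of_real_add poly_map_of_real_mult dz uv
      by (simp add: map_poly_pCons)
    then have "u = 0 \<and> v = 0"
      using False by (auto simp: complex_eq_iff)
    then have "q = d * (q div d)"
      using uv div_mult_mod_eq[of q d] by (simp add: mult.commute)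
    then show ?thesis using quadratic[of b a] False by (simp add: d_def b_def)
  qed
qed

text \<open>One inclusion of the spectral mapping theorem. Linear factors are invertible
  by the definition of the spectrum, and \<open>(T - a)\<^sup>2 + b\<^sup>2\<close> is coercive.\<close>

lemma invertible_op_poly:
  assumes T: "selfadjoint T"
  shows "q \<noteq> 0 \<Longrightarrow> (\<And>t. t \<in> real_spectrum T \<Longrightarrow> poly q t \<noteq> 0) \<Longrightarrow> invertible_op (op_poly q T)"
proof (induction "degree q" arbitrary: q rule: less_induct)
  case less
  show ?case
  proof (cases "degree q = 0")
    case True
    then obtain c where "q = [:c:]" by (rule degree_eq_zeroE)
    with less.prems(1) show ?thesis by (simp add: op_poly_const invertible_op_scaleR_id)
  next
    case False
    then have "0 < degree q" by simp
    then show ?thesis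
    proof (cases rule: real_poly_factor)
      case (linear r s)
      have s: "s \<noteq> 0" using less.prems(1) linear by auto
      have "degree s < degree q"
        unfolding linear using s by (subst degree_mult_eq) auto
      moreover have "poly s t \<noteq> 0" if "t \<in> real_spectrum T" for t
        using less.prems(2)[OF that] linear by auto
      ultimately have "invertible_op (op_poly s T)" using less.hyps s by blast
      moreover have "r \<notin> real_spectrum T" using less.prems(2)[of r] linear by auto
      then have "invertible_op (op_poly [:- r, 1:] T)"
        by (simp add: real_spectrum_iff op_poly_linear)
      ultimately show ?thesis unfolding linear op_poly_mult by (intro invertible_op_compose)
    next
      case (quadratic a b s)
      define l where "l = [:- a, 1:]"
      have q: "q = (l * l + [:b\<^sup>2:]) * s" using quadratic by (simp add: l_def)
      have d: "l * l + [:b\<^sup>2:] = [:a\<^sup>2 + b\<^sup>2, - 2 * a, 1:]"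
        by (simp add: l_def power2_eq_square)
      have s: "s \<noteq> 0" using less.prems(1) q by auto
      have "degree s < degree q"
        unfolding q d using s by (subst degree_mult_eq) auto
      moreover have "poly s t \<noteq> 0" if "t \<in> real_spectrum T" for t
        using less.prems(2)[OF that] q by auto
      ultimately have "invertible_op (op_poly s T)" using less.hyps s by blast
      moreover have "invertible_op (op_poly (l * l + [:b\<^sup>2:]) T)"
      proof (rule coercive_imp_invertible_op)
        show "selfadjoint (op_poly (l * l + [:b\<^sup>2:]) T)" by (rule selfadjoint_op_poly[OF T])
        show "0 < b\<^sup>2" using quadratic(1) by simp
        fix x
        have "rinner (op_poly (l * l + [:b\<^sup>2:]) T x) x = (norm (op_poly l T x))\<^sup>2 + b\<^sup>2 * (norm x)\<^sup>2"
          using selfadjoint_rinner[OF selfadjoint_op_poly[OF T], of l "op_poly l T x" x]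
          by (simp add: op_poly_add op_poly_mult op_poly_const rinner_simps)
        then show "b\<^sup>2 * (norm x)\<^sup>2 \<le> rinner (op_poly (l * l + [:b\<^sup>2:]) T x) x" by simp
      qed
      ultimately show ?thesis unfolding q op_poly_mult by (intro invertible_op_compose)
    qed
  qed
qed

text \<open>The infimum of the numerical range belongs to the spectrum: otherwise
  \<open>S - \<mu>\<close> would be positive and invertible, and its form could be bounded below by a positive
  constant.\<close>

lemma bottom_of_form_in_spectrum:
  fixes S :: "'a::chilbert_space \<Rightarrow>\<^sub>L 'a"
  assumes S: "selfadjoint S" and x0: "(x0::'a) \<noteq> 0"
  obtains \<mu> where "\<mu> \<in> real_spectrum S" "\<And>x. \<mu> * (norm x)\<^sup>2 \<le> rinner (S x) x"
proof -
  define Q where "Q = {rinner (S x) x | x. norm x = 1}"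
  define \<mu> where "\<mu> = Inf Q"
  have "rinner (S (x0 /\<^sub>R norm x0)) (x0 /\<^sub>R norm x0) \<in> Q"
    unfolding Q_def using x0 by (intro CollectI exI[of _ "x0 /\<^sub>R norm x0"]) simp
  then have ne: "Q \<noteq> {}" by blast
  have bdd: "bdd_below Q"
  proof (rule bdd_belowI[of _ "- norm S"])
    show "- norm S \<le> y" if y: "y \<in> Q" for y
    proof -
      obtain x where "y = rinner (S x) x" "norm x = 1" using y by (auto simp: Q_def)
      then show ?thesis using abs_form_le_norm[of S x] by simp
    qed
  qed
  have scale: "c * (norm x)\<^sup>2 \<le> rinner (S x) x" if c: "\<And>y. y \<in> Q \<Longrightarrow> c \<le> y" for c x
  proof (cases "x = 0")
    case False
    define u where "u = x /\<^sub>R norm x"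
    have xu: "x = norm x *\<^sub>R u" and "norm u = 1" using False by (auto simp: u_def)
    then have "c \<le> rinner (S u) u" using c by (auto simp: Q_def)
    moreover have "rinner (S x) x = (norm x)\<^sup>2 * rinner (S u) u"
      by (subst (1 2) xu) (simp add: rinner_simps power2_eq_square)
    ultimately show ?thesis by (simp add: mult.commute mult_right_mono)
  qed (simp add: rinner_zero_right)
  have lb: "\<mu> * (norm x)\<^sup>2 \<le> rinner (S x) x" for x
    by (rule scale) (simp add: \<mu>_def cInf_lower bdd)
  define D where "D = S - \<mu> *\<^sub>R id_blinfun"
  have D: "selfadjoint D" unfolding D_def
    by (intro selfadjoint_diff selfadjoint_scaleR selfadjoint_id S)
  have Dx: "rinner (D x) x = rinner (S x) x - \<mu> * (norm x)\<^sup>2" for x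
    by (simp add: D_def rinner_simps)
  have "\<not> invertible_op D"
  proof
    assume "invertible_op D"
    then obtain R where R: "is_inverse_op D R" by (auto simp: invertible_op_def)
    have "R (D x0) = x0"
      using R by (auto simp: is_inverse_op_def dest: arg_cong[where f="\<lambda>f. blinfun_apply f x0"])
    then have "R \<noteq> 0" using x0 by (auto simp: blinfun.zero_left)
    then have pos: "0 < 1 / norm R" by simp
    have gap: "(norm x)\<^sup>2 / norm R \<le> rinner (D x) x" for x
      by (rule positive_inverse_lower_bound[OF D _ R]) (use lb Dx in auto)
    have "\<mu> + 1 / norm R \<le> Inf Q"
    proof (rule cInf_greatest[OF ne])
      fix y assume "y \<in> Q"
      then obtain x where x: "y = rinner (S x) x" "norm x = 1" by (auto simp: Q_def)
      then show "\<mu> + 1 / norm R \<le> y" using gap[of x] Dx[of x] by simp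
    qed
    then show False using pos by (simp add: \<mu>_def)
  qed
  then have "\<mu> \<in> real_spectrum S" by (simp add: real_spectrum_iff D_def)
  then show thesis using that lb by blast
qed

text \<open>The infimum of the numerical range of \<open>p(T)\<close> is a spectral value of \<open>p(T)\<close>, hence a value
  of \<open>p\<close> on the spectrum of \<open>T\<close>.\<close>

lemma op_poly_nonneg:
  fixes T :: "'a::chilbert_space \<Rightarrow>\<^sub>L 'a"
  assumes T: "selfadjoint T" and p: "\<And>t. t \<in> real_spectrum T \<Longrightarrow> 0 \<le> poly p t"
  shows "0 \<le> rinner (op_poly p T x) x"
proof (rule ccontr)
  assume neg: "\<not> 0 \<le> rinner (op_poly p T x) x"
  then have x: "x \<noteq> 0" by (auto simp: rinner_zero_right)
  obtain \<mu> where \<mu>: "\<mu> \<in> real_spectrum (op_poly p T)"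
    and lb: "\<mu> * (norm x)\<^sup>2 \<le> rinner (op_poly p T x) x"
    using bottom_of_form_in_spectrum[OF selfadjoint_op_poly[OF T] x] by metis
  have "\<mu> * (norm x)\<^sup>2 < 0" using neg lb by linarith
  then have "\<mu> < 0" by (simp add: mult_less_0_iff)
  obtain \<tau> where \<tau>: "\<tau> \<in> real_spectrum T"
    using bottom_of_form_in_spectrum[OF T x] by metis
  have q: "p - [:\<mu>:] \<noteq> 0"
  proof
    \<comment> \<open>For constant \<open>p\<close> the hypothesis has content because the spectrum contains \<open>\<tau>\<close>.\<close>
    assume "p - [:\<mu>:] = 0"
    then have "p = [:\<mu>:]" by simp
    then show False using p[OF \<tau>] \<open>\<mu> < 0\<close> by simp
  qed
  have "\<not> invertible_op (op_poly (p - [:\<mu>:]) T)"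
    using \<mu> by (simp add: real_spectrum_iff op_poly_diff op_poly_const)
  then obtain t where "t \<in> real_spectrum T" "poly (p - [:\<mu>:]) t = 0"
    using invertible_op_poly[OF T q] by blast
  then show False using p[of t] \<open>\<mu> < 0\<close> by simp
qed

text \<open>Positivity of \<open>c\<^sup>2 - p\<^sup>2\<close> bounds the norm, since \<open>\<langle>p(T)\<^sup>2 x, x\<rangle> = \<parallel>p(T) x\<parallel>\<^sup>2\<close>.\<close>

lemma norm_op_poly_le:
  assumes T: "selfadjoint T" and p: "\<And>t. t \<in> real_spectrum T \<Longrightarrow> \<bar>poly p t\<bar> \<le> c" and c: "0 \<le> c"
  shows "norm (op_poly p T) \<le> c"
proof (rule norm_blinfun_bound[OF c])
  fix x
  have "0 \<le> rinner (op_poly ([:c\<^sup>2:] - p * p) T x) x"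
  proof (rule op_poly_nonneg[OF T])
    fix t assume "t \<in> real_spectrum T"
    then have "\<bar>poly p t\<bar>\<^sup>2 \<le> c\<^sup>2" by (intro power_mono p) auto
    then show "0 \<le> poly ([:c\<^sup>2:] - p * p) t" by (simp add: power2_eq_square)
  qed
  also have "\<dots> = c\<^sup>2 * (norm x)\<^sup>2 - (norm (op_poly p T x))\<^sup>2"
    using selfadjoint_rinner[OF selfadjoint_op_poly[OF T], of p "op_poly p T x" x]
    by (simp add: op_poly_diff op_poly_mult op_poly_const rinner_simps)
  finally have "(norm (op_poly p T x))\<^sup>2 \<le> (c * norm x)\<^sup>2" by (simp add: power_mult_distrib)
  then show "norm (op_poly p T x) \<le> c * norm x"
    by (rule power2_le_imp_le) (simp add: c)
qed

section \<open>The continuous functional calculus\<close>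

text \<open>Polynomials that converge uniformly on the spectrum have norm-convergent values, and the
  limit does not depend on the polynomials; so the unique existence that the definition of the
  functional calculus presupposes holds.\<close>

lemma LIMSEQ_fun_calc:
  assumes T: "selfadjoint T"
    and p: "uniform_limit (real_spectrum T) (\<lambda>n. poly (p n)) f sequentially"
  shows "(\<lambda>n. op_poly (p n) T) \<longlonglongrightarrow> fun_calc f T"
proof -
  have close: "norm (op_poly q T - op_poly q' T) \<le> 2 * e"
    if "0 < e" "\<forall>t\<in>real_spectrum T. dist (poly q t) (f t) < e"
      "\<forall>t\<in>real_spectrum T. dist (poly q' t) (f t) < e" for q q' e
    unfolding op_poly_diff[symmetric]
  proof (rule norm_op_poly_le[OF T])
    fix t assume t: "t \<in> real_spectrum T"
    have "dist (poly q t) (f t) < e" "dist (poly q' t) (f t) < e" using t that by auto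
    then show "\<bar>poly (q - q') t\<bar> \<le> 2 * e" by (simp add: dist_real_def)
  qed (use that in simp)
  have "Cauchy (\<lambda>n. op_poly (p n) T)"
  proof (rule metric_CauchyI)
    fix e :: real assume "0 < e"
    then obtain N where N: "\<forall>n\<ge>N. \<forall>t\<in>real_spectrum T. dist (poly (p n) t) (f t) < e / 4"
      using p unfolding uniform_limit_sequentially_iff by (meson divide_pos_pos zero_less_numeral)
    have "dist (op_poly (p m) T) (op_poly (p n) T) < e" if "m \<ge> N" "n \<ge> N" for m n
    proof -
      have "norm (op_poly (p m) T - op_poly (p n) T) \<le> 2 * (e / 4)"
        using that N \<open>0 < e\<close> by (intro close) auto
      then show ?thesis using \<open>0 < e\<close> by (simp add: dist_norm)
    qed
    then show "\<exists>M. \<forall>m\<ge>M. \<forall>n\<ge>M. dist (op_poly (p m) T) (op_poly (p n) T) < e" by blast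
  qed
  then obtain L where L: "(\<lambda>n. op_poly (p n) T) \<longlonglongrightarrow> L"
    using Cauchy_convergent convergent_def by blast
  have all: "(\<lambda>n. op_poly (q n) T) \<longlonglongrightarrow> L"
    if q: "uniform_limit (real_spectrum T) (\<lambda>n. poly (q n)) f sequentially" for q
  proof -
    have "(\<lambda>n. op_poly (q n) T - op_poly (p n) T) \<longlonglongrightarrow> 0"
    proof (rule metric_LIMSEQ_I)
      fix e :: real assume e: "0 < e"
      obtain N where N: "\<forall>n\<ge>N. \<forall>t\<in>real_spectrum T. dist (poly (p n) t) (f t) < e / 4"
        using p e unfolding uniform_limit_sequentially_iff by (meson divide_pos_pos zero_less_numeral)
      obtain M where M: "\<forall>n\<ge>M. \<forall>t\<in>real_spectrum T. dist (poly (q n) t) (f t) < e / 4"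
        using q e unfolding uniform_limit_sequentially_iff by (meson divide_pos_pos zero_less_numeral)
      have "dist (op_poly (q n) T - op_poly (p n) T) 0 < e" if "n \<ge> max M N" for n
      proof -
        have "norm (op_poly (q n) T - op_poly (p n) T) \<le> 2 * (e / 4)"
          using that N M e by (intro close) auto
        then show ?thesis using e by (simp add: dist_norm)
      qed
      then show "\<exists>no. \<forall>n\<ge>no. dist (op_poly (q n) T - op_poly (p n) T) 0 < e" by blast
    qed
    from tendsto_add[OF this L] show ?thesis by simp
  qed
  have "fun_calc f T = L"
    unfolding fun_calc_def real_spectrum_def[symmetric]
  proof (rule the_equality)
    show "\<forall>q. uniform_limit (real_spectrum T) (\<lambda>n. poly (q n)) f sequentially
        \<longrightarrow> (\<lambda>n. op_poly (q n) T) \<longlonglongrightarrow> L"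
      using all by blast
    fix S assume "\<forall>q. uniform_limit (real_spectrum T) (\<lambda>n. poly (q n)) f sequentially
        \<longrightarrow> (\<lambda>n. op_poly (q n) T) \<longlonglongrightarrow> S"
    then show "S = L" using p L LIMSEQ_unique by blast
  qed
  with L show ?thesis by simp
qed

lemma Weierstrass_poly_sequence:
  fixes f :: "real \<Rightarrow> real"
  assumes f: "continuous_on {a..b} f"
  obtains p :: "nat \<Rightarrow> real poly"
  where "uniform_limit {a..b} (\<lambda>n. poly (p n)) f sequentially"
proof -
  have "\<exists>p. \<forall>t\<in>{a..b}. \<bar>f t - poly p t\<bar> < 1 / real (Suc n)" for n
  proof -
    obtain g where g: "real_polynomial_function g" "\<And>t. t \<in> {a..b} \<Longrightarrow> \<bar>f t - g t\<bar> < 1 / real (Suc n)"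
      using Stone_Weierstrass_real_polynomial_function[OF compact_Icc f, of "1 / real (Suc n)"]
      by auto
    then obtain c m where "g = (\<lambda>x. \<Sum>i\<le>m. c i * x ^ i)"
      using real_polynomial_function_iff_sum by blast
    then have "g t = poly (\<Sum>i\<le>m. monom (c i) i) t" for t
      by (simp add: poly_sum poly_monom)
    then show ?thesis using g(2) by metis
  qed
  then obtain p where p: "\<And>n t. t \<in> {a..b} \<Longrightarrow> \<bar>f t - poly (p n) t\<bar> < 1 / real (Suc n)"
    by metis
  have "uniform_limit {a..b} (\<lambda>n. poly (p n)) f sequentially"
    unfolding uniform_limit_sequentially_iff
  proof (intro allI impI)
    fix e :: real assume "0 < e"
    then obtain N where N: "1 / real (Suc N) < e" using nat_approx_posE by blast
    have "dist (poly (p n) t) (f t) < e" if "n \<ge> N" "t \<in> {a..b}" for n t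
    proof -
      have "1 / real (Suc n) \<le> 1 / real (Suc N)" using that by (simp add: frac_le)
      then show ?thesis using p[OF that(2), of n] N by (simp add: dist_real_def abs_minus_commute)
    qed
    then show "\<exists>N. \<forall>n\<ge>N. \<forall>t\<in>{a..b}. dist (poly (p n) t) (f t) < e" by blast
  qed
  then show thesis by (rule that)
qed

definition form_between :: "real \<Rightarrow> real \<Rightarrow> ('a::chilbert_space \<Rightarrow>\<^sub>L 'a) \<Rightarrow> bool"
  where "form_between a b T \<longleftrightarrow> selfadjoint T \<and>
           (\<forall>x. a * (norm x)\<^sup>2 \<le> rinner (T x) x \<and> rinner (T x) x \<le> b * (norm x)\<^sup>2)"

text \<open>Outside the interval, \<open>T - t\<close> or its negative is coercive. This makes statements about
  functions on the spectrum available from bounds of the form.\<close>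

lemma form_between_real_spectrum:
  assumes "form_between a b T" shows "real_spectrum T \<subseteq> {a..b}"
proof
  fix t assume t: "t \<in> real_spectrum T"
  have T: "selfadjoint T" and lo: "a * (norm x)\<^sup>2 \<le> rinner (T x) x"
    and hi: "rinner (T x) x \<le> b * (norm x)\<^sup>2" for x
    using assms by (auto simp: form_between_def)
  have "a \<le> t"
  proof (rule ccontr)
    assume "\<not> a \<le> t"
    moreover have "(a - t) * (norm x)\<^sup>2 \<le> rinner ((T - t *\<^sub>R id_blinfun) x) x" for x
      using lo[of x] by (simp add: rinner_simps algebra_simps)
    ultimately have "invertible_op (T - t *\<^sub>R id_blinfun)"
      using T by (intro coercive_imp_invertible_op[of _ "a - t"] selfadjoint_diff
          selfadjoint_scaleR selfadjoint_id) auto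
    with t show False by (simp add: real_spectrum_iff)
  qed
  moreover have "t \<le> b"
  proof (rule ccontr)
    assume "\<not> t \<le> b"
    moreover have "(t - b) * (norm x)\<^sup>2 \<le> rinner ((t *\<^sub>R id_blinfun - T) x) x" for x
      using hi[of x] by (simp add: rinner_simps algebra_simps)
    ultimately have "invertible_op (t *\<^sub>R id_blinfun - T)"
      using T by (intro coercive_imp_invertible_op[of _ "t - b"] selfadjoint_diff
          selfadjoint_scaleR selfadjoint_id) auto
    then have "invertible_op ((- 1) *\<^sub>R id_blinfun o\<^sub>L (t *\<^sub>R id_blinfun - T))"
      by (intro invertible_op_compose invertible_op_scaleR_id) auto
    also have "(- 1) *\<^sub>R id_blinfun o\<^sub>L (t *\<^sub>R id_blinfun - T) = T - t *\<^sub>R id_blinfun"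
      by (rule blinfun_eqI) (simp add: rinner_simps)
    finally show False using t by (simp add: real_spectrum_iff)
  qed
  ultimately show "t \<in> {a..b}" by simp
qed

lemma LIMSEQ_fun_calc_interval:
  assumes T: "form_between a b T" and p: "uniform_limit {a..b} (\<lambda>n. poly (p n)) f sequentially"
  shows "(\<lambda>n. op_poly (p n) T) \<longlonglongrightarrow> fun_calc f T"
  using T uniform_limit_on_subset[OF p form_between_real_spectrum[OF T]]
  by (intro LIMSEQ_fun_calc) (auto simp: form_between_def)

lemma selfadjoint_fun_calc:
  assumes T: "form_between a b T" and f: "continuous_on {a..b} f"
  shows "selfadjoint (fun_calc f T)"
proof -
  obtain p where p: "uniform_limit {a..b} (\<lambda>n. poly (p n)) f sequentially"
    using Weierstrass_poly_sequence[OF f] .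
  show ?thesis
    by (rule selfadjoint_LIMSEQ[OF selfadjoint_op_poly LIMSEQ_fun_calc_interval[OF T p]])
       (use T in \<open>simp add: form_between_def\<close>)
qed

lemma fun_calc_eqI:
  assumes T: "form_between a b T" and p: "uniform_limit {a..b} (\<lambda>n. poly (p n)) f sequentially"
    and lim: "(\<lambda>n. op_poly (p n) T) \<longlonglongrightarrow> S"
  shows "fun_calc f T = S"
  using LIMSEQ_fun_calc_interval[OF T p] lim by (rule LIMSEQ_unique)

lemma fun_calc_poly:
  assumes T: "form_between a b T" and f: "\<And>t. t \<in> {a..b} \<Longrightarrow> f t = poly q t"
  shows "fun_calc f T = op_poly q T"
proof (rule fun_calc_eqI[OF T])
  show "uniform_limit {a..b} (\<lambda>n. poly q) f sequentially"
    using f by (simp add: uniform_limit_sequentially_iff)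
qed simp

lemma fun_calc_one:
  assumes T: "form_between a b T" and f: "\<And>t. t \<in> {a..b} \<Longrightarrow> f t = 1"
  shows "fun_calc f T = id_blinfun"
  using fun_calc_poly[OF T, of f "[:1:]"] f by (simp add: op_poly_const)

lemma fun_calc_ident:
  assumes T: "form_between a b T" and f: "\<And>t. t \<in> {a..b} \<Longrightarrow> f t = t"
  shows "fun_calc f T = T"
  using fun_calc_poly[OF T, of f "[:0, 1:]"] f by (simp add: op_poly_linear)

lemma fun_calc_cong:
  assumes T: "form_between a b T" and f: "continuous_on {a..b} f"
    and fg: "\<And>t. t \<in> {a..b} \<Longrightarrow> f t = g t"
  shows "fun_calc f T = fun_calc g T"
proof -
  obtain p where p: "uniform_limit {a..b} (\<lambda>n. poly (p n)) f sequentially"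
    using Weierstrass_poly_sequence[OF f] .
  have "uniform_limit {a..b} (\<lambda>n. poly (p n)) g sequentially"
    using p fg by (simp add: uniform_limit_sequentially_iff)
  from fun_calc_eqI[OF T p LIMSEQ_fun_calc_interval[OF T this]] show ?thesis .
qed

lemma fun_calc_linear:
  assumes T: "form_between a b T" and f: "continuous_on {a..b} f" and g: "continuous_on {a..b} g"
  shows "fun_calc (\<lambda>t. c * f t + d * g t) T = c *\<^sub>R fun_calc f T + d *\<^sub>R fun_calc g T"
proof -
  obtain p where p: "uniform_limit {a..b} (\<lambda>n. poly (p n)) f sequentially"
    using Weierstrass_poly_sequence[OF f] .
  obtain q where q: "uniform_limit {a..b} (\<lambda>n. poly (q n)) g sequentially"
    using Weierstrass_poly_sequence[OF g] .
  have scale: "uniform_limit {a..b} (\<lambda>n x. k * h n x) (\<lambda>x. k * l x) sequentially"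
    if "uniform_limit {a..b} h l sequentially" for k :: real and h l
    by (rule bounded_linear.uniform_limit[OF bounded_linear_mult_right that])
  show ?thesis
  proof (rule fun_calc_eqI[OF T])
    show "uniform_limit {a..b} (\<lambda>n. poly (smult c (p n) + smult d (q n)))
        (\<lambda>t. c * f t + d * g t) sequentially"
      using uniform_limit_add[OF scale[OF p, of c] scale[OF q, of d]] by (simp add: poly_add[abs_def])
    show "(\<lambda>n. op_poly (smult c (p n) + smult d (q n)) T)
        \<longlonglongrightarrow> c *\<^sub>R fun_calc f T + d *\<^sub>R fun_calc g T"
      unfolding op_poly_add op_poly_smult
      by (rule tendsto_add[OF tendsto_scaleR[OF tendsto_const LIMSEQ_fun_calc_interval[OF T p]]
          tendsto_scaleR[OF tendsto_const LIMSEQ_fun_calc_interval[OF T q]]])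
  qed
qed

lemma fun_calc_diff:
  assumes T: "form_between a b T" and f: "continuous_on {a..b} f" and g: "continuous_on {a..b} g"
  shows "fun_calc (\<lambda>t. f t - g t) T = fun_calc f T - fun_calc g T"
  using fun_calc_linear[OF assms, of 1 "-1"] by simp

lemma fun_calc_mult:
  assumes T: "form_between a b T" and f: "continuous_on {a..b} f" and g: "continuous_on {a..b} g"
  shows "fun_calc (\<lambda>t. f t * g t) T = fun_calc f T o\<^sub>L fun_calc g T"
proof -
  obtain p where p: "uniform_limit {a..b} (\<lambda>n. poly (p n)) f sequentially"
    using Weierstrass_poly_sequence[OF f] .
  obtain q where q: "uniform_limit {a..b} (\<lambda>n. poly (q n)) g sequentially"
    using Weierstrass_poly_sequence[OF g] .
  have bounded: "bounded (h ` {a..b})" if "continuous_on {a..b} h" for h :: "real \<Rightarrow> real"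
    using compact_continuous_image[OF that compact_Icc] by (rule compact_imp_bounded)
  show ?thesis
  proof (rule fun_calc_eqI[OF T])
    show "uniform_limit {a..b} (\<lambda>n. poly (p n * q n)) (\<lambda>t. f t * g t) sequentially"
      using uniform_lim_mult[OF p q bounded[OF f] bounded[OF g]] by (simp add: poly_mult[abs_def])
    show "(\<lambda>n. op_poly (p n * q n) T) \<longlonglongrightarrow> (fun_calc f T o\<^sub>L fun_calc g T)"
      unfolding op_poly_mult
      by (rule bounded_bilinear.tendsto[OF bounded_bilinear_blinfun_compose
            LIMSEQ_fun_calc_interval[OF T p] LIMSEQ_fun_calc_interval[OF T q]])
  qed
qed

text \<open>A nonnegative function is a square, so its value at an operator is the square of a
  self-adjoint operator.\<close>

lemma fun_calc_nonneg:
  assumes T: "form_between a b T" and f: "continuous_on {a..b} f"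
    and nonneg: "\<And>t. t \<in> {a..b} \<Longrightarrow> 0 \<le> f t"
  shows "0 \<le> rinner (fun_calc f T x) x"
proof -
  define g where "g = (\<lambda>t. sqrt (f t))"
  have g: "continuous_on {a..b} g" unfolding g_def by (intro continuous_intros f)
  have "fun_calc f T = fun_calc (\<lambda>t. g t * g t) T"
    by (rule fun_calc_cong[OF T f]) (simp add: g_def nonneg)
  also have "\<dots> = fun_calc g T o\<^sub>L fun_calc g T" by (rule fun_calc_mult[OF T g g])
  finally have "rinner (fun_calc f T x) x = (norm (fun_calc g T x))\<^sup>2"
    using selfadjoint_rinner[OF selfadjoint_fun_calc[OF T g]] by (simp add: rinner_self)
  then show ?thesis by simp
qed

lemma fun_calc_mono:
  assumes T: "form_between a b T" and f: "continuous_on {a..b} f" and g: "continuous_on {a..b} g"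
    and le: "\<And>t. t \<in> {a..b} \<Longrightarrow> f t \<le> g t"
  shows "rinner (fun_calc f T x) x \<le> rinner (fun_calc g T x) x"
proof -
  have "0 \<le> rinner (fun_calc (\<lambda>t. g t - f t) T x) x"
    by (rule fun_calc_nonneg[OF T continuous_on_diff[OF g f]]) (simp add: le)
  also have "\<dots> = rinner (fun_calc g T x) x - rinner (fun_calc f T x) x"
    unfolding fun_calc_diff[OF T g f] by (simp add: rinner_simps)
  finally show ?thesis by simp
qed

lemma fun_calc_affine:
  assumes T: "form_between a b T" and f: "continuous_on {a..b} f"
  shows "rinner (fun_calc (\<lambda>t. c * f t + d) T x) x
    = c * rinner (fun_calc f T x) x + d * (norm x)\<^sup>2"
proof -
  have "fun_calc (\<lambda>t. 1) T = id_blinfun" by (rule fun_calc_one[OF T]) simp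
  then show ?thesis
    using fun_calc_linear[OF T f, of "\<lambda>t. 1" c d] by (simp add: rinner_simps)
qed

lemma form_between_shift:
  "form_between a b T \<Longrightarrow> form_between (a + c) (b + c) (T + c *\<^sub>R id_blinfun)"
  by (auto simp: form_between_def rinner_simps algebra_simps
      intro!: selfadjoint_add selfadjoint_scaleR selfadjoint_id)

lemma fun_calc_shift:
  assumes T: "form_between a b T" and f: "continuous_on {a + c..b + c} f"
  shows "fun_calc f (T + c *\<^sub>R id_blinfun) = fun_calc (\<lambda>t. f (t + c)) T"
proof -
  obtain p where p: "uniform_limit {a + c..b + c} (\<lambda>n. poly (p n)) f sequentially"
    using Weierstrass_poly_sequence[OF f] .
  have q: "uniform_limit {a..b} (\<lambda>n. poly (pcompose (p n) [:c, 1:])) (\<lambda>t. f (t + c)) sequentially"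
    unfolding uniform_limit_sequentially_iff
  proof (intro allI impI)
    fix e :: real assume "0 < e"
    then obtain N where "\<forall>n\<ge>N. \<forall>t\<in>{a + c..b + c}. dist (poly (p n) t) (f t) < e"
      using p unfolding uniform_limit_sequentially_iff by blast
    then show "\<exists>N. \<forall>n\<ge>N. \<forall>t\<in>{a..b}. dist (poly (pcompose (p n) [:c, 1:]) t) (f (t + c)) < e"
      by (intro exI[of _ N]) (simp add: poly_pcompose add.commute)
  qed
  have "(\<lambda>n. op_poly (pcompose (p n) [:c, 1:]) T) \<longlonglongrightarrow> fun_calc f (T + c *\<^sub>R id_blinfun)"
    unfolding op_poly_pcompose op_poly_linear
    by (rule LIMSEQ_fun_calc_interval[OF form_between_shift[OF T] p])
  from fun_calc_eqI[OF T q this] show ?thesis by simp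
qed

section \<open>Powers on the half-line\<close>

lemma continuous_on_powr_nonneg:
  fixes a b r :: real
  assumes "0 \<le> a" "0 < r" shows "continuous_on {a..b} (\<lambda>t. t powr r)"
  by (rule continuous_on_powr') (use assms in \<open>auto intro!: continuous_on_id continuous_on_const\<close>)

lemma continuous_on_powr_pos:
  fixes a b r :: real
  assumes "0 < a" shows "continuous_on {a..b} (\<lambda>t. t powr r)"
  by (rule continuous_on_powr) (use assms in \<open>auto intro!: continuous_on_id continuous_on_const\<close>)

text \<open>The power function is concave for exponents at most one, so its increments over steps of
  fixed length decrease.\<close>

lemma powr_increment_antimono:
  fixes s t m r :: real
  assumes m: "0 \<le> m" "m \<le> s" "s \<le> t" and r: "0 < r" "r \<le> 1"
  shows "t powr r - (t - m) powr r \<le> s powr r - (s - m) powr r"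
proof (rule DERIV_nonpos_imp_decreasing_open[OF m(3)])
  fix x assume x: "s < x" "x < t"
  then have "0 < x - m" "0 < x" using m by auto
  then have "((\<lambda>x. x powr r - (x - m) powr r) has_real_derivative
      r * x powr (r - 1) - r * (x - m) powr (r - 1)) (at x)"
    by (auto intro!: derivative_eq_intros)
  moreover have "x powr (r - 1) \<le> (x - m) powr (r - 1)"
    using \<open>0 < x - m\<close> m r by (intro powr_mono2') auto
  then have "r * x powr (r - 1) - r * (x - m) powr (r - 1) \<le> 0"
    using r by simp
  ultimately show "\<exists>y. ((\<lambda>x. x powr r - (x - m) powr r) has_real_derivative y) (at x) \<and> y \<le> 0"
    by blast
next
  show "continuous_on {s..t} (\<lambda>x. x powr r - (x - m) powr r)"
  proof (rule continuous_on_diff)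
    show "continuous_on {s..t} (\<lambda>x. x powr r)"
      using m r by (intro continuous_on_powr_nonneg) auto
    show "continuous_on {s..t} (\<lambda>x. (x - m) powr r)"
      by (rule continuous_on_powr') (use m r in \<open>auto intro!: continuous_intros\<close>)
  qed
qed

lemma powr_subadditive:
  fixes t e r :: real
  assumes "0 \<le> t" "0 \<le> e" "0 < r" "r \<le> 1"
  shows "(t + e) powr r \<le> t powr r + e powr r"
  using powr_increment_antimono[of e e "t + e" r] assms by simp

section \<open>The Loewner--Heinz inequality\<close>

lemma selfadjoint_op_powr:
  "form_between a b T \<Longrightarrow> 0 < a \<Longrightarrow> selfadjoint (op_powr T r)"
  unfolding op_powr_def by (rule selfadjoint_fun_calc) (auto intro: continuous_on_powr_pos)

lemma op_powr_add:
  assumes T: "form_between a b T" and a: "0 < a"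
  shows "op_powr T (r + s) = op_powr T r o\<^sub>L op_powr T s"
  unfolding op_powr_def powr_add
  by (rule fun_calc_mult[OF T]) (auto intro: continuous_on_powr_pos a)

lemma op_powr_zero:
  assumes T: "form_between a b T" and a: "0 < a"
  shows "op_powr T 0 = id_blinfun"
  unfolding op_powr_def by (rule fun_calc_one[OF T]) (use a in auto)

lemma op_powr_one:
  assumes T: "form_between a b T" and a: "0 < a"
  shows "op_powr T 1 = T"
  unfolding op_powr_def by (rule fun_calc_ident[OF T]) (use a in auto)

text \<open>An operator similar to a contraction has no spectrum above one, so for a self-adjoint operator
  the supremum \<open>\<nu>\<close> of the numerical range, which is a spectral value, is at most one.\<close>

lemma form_le_of_similar_contraction:
  fixes T Z V W :: "'a::chilbert_space \<Rightarrow>\<^sub>L 'a"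
  assumes T: "selfadjoint T"
    and sim: "\<And>x. W (T x) = Z (W x)" and inv: "\<And>x. V (W x) = x"
    and Z: "\<And>x. norm (Z x) \<le> norm x"
  shows "rinner (T x) x \<le> (norm x)\<^sup>2"
proof (cases "x = 0")
  case True
  then show ?thesis by (simp add: rinner_zero_right)
next
  case False
  have "selfadjoint ((- 1) *\<^sub>R T)" by (rule selfadjoint_scaleR[OF T])
  then obtain \<mu> where \<mu>: "\<mu> \<in> real_spectrum ((- 1) *\<^sub>R T)"
    and lb: "\<And>x. \<mu> * (norm x)\<^sup>2 \<le> rinner (((- 1) *\<^sub>R T) x) x"
    using bottom_of_form_in_spectrum[OF _ False] by blast
  define \<nu> where "\<nu> = - \<mu>"
  define D where "D = (- 1) *\<^sub>R T - \<mu> *\<^sub>R id_blinfun"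
  have Dx: "D x = \<nu> *\<^sub>R x - T x" for x by (simp add: D_def \<nu>_def rinner_simps)
  have D: "selfadjoint D" unfolding D_def
    by (intro selfadjoint_diff selfadjoint_scaleR selfadjoint_id T)
  have top: "rinner (T x) x \<le> \<nu> * (norm x)\<^sup>2" for x
    using lb[of x] by (simp add: rinner_simps \<nu>_def)
  have "\<nu> \<le> 1"
  proof (rule ccontr)
    assume "\<not> \<nu> \<le> 1"
    then have \<nu>: "1 < \<nu>" by simp
    define K where "K = (norm V + 1) * (norm W + 1)"
    have K: "0 < K" unfolding K_def by (intro mult_pos_pos add_nonneg_pos) auto
    \<comment> \<open>Above the spectral radius, the resolvent estimate of the contraction carries over to \<open>T\<close>.\<close>
    have below: "(\<nu> - 1) * norm x \<le> K * norm (D x)" for x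
    proof -
      have "norm x \<le> norm V * norm (W x)" using norm_blinfun[of V "W x"] by (simp add: inv)
      also have "\<dots> \<le> (norm V + 1) * norm (W x)" by (intro mult_right_mono) auto
      finally have 1: "norm x \<le> (norm V + 1) * norm (W x)" .
      have "W (D x) = \<nu> *\<^sub>R W x - Z (W x)" by (simp add: Dx blinfun.diff_right blinfun.scaleR_right sim)
      then have "norm (\<nu> *\<^sub>R W x) - norm (Z (W x)) \<le> norm (W (D x))"
        by (metis norm_triangle_ineq2)
      then have "(\<nu> - 1) * norm (W x) \<le> norm (W (D x))"
        using Z[of "W x"] \<nu> by (simp add: algebra_simps)
      also have "\<dots> \<le> norm W * norm (D x)" by (rule norm_blinfun)
      also have "\<dots> \<le> (norm W + 1) * norm (D x)" by (intro mult_right_mono) auto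
      finally have 2: "(\<nu> - 1) * norm (W x) \<le> (norm W + 1) * norm (D x)" .
      have "(\<nu> - 1) * norm x \<le> (\<nu> - 1) * ((norm V + 1) * norm (W x))"
        using \<nu> by (intro mult_left_mono 1) simp
      also have "\<dots> = (norm V + 1) * ((\<nu> - 1) * norm (W x))" by simp
      also have "\<dots> \<le> (norm V + 1) * ((norm W + 1) * norm (D x))" by (intro mult_left_mono 2) simp
      finally show ?thesis by (simp add: K_def mult.assoc)
    qed
    define k where "k = norm D + 1"
    have k: "0 < k" by (simp add: k_def add_nonneg_pos)
    define c where "c = (\<nu> - 1) / K"
    have c: "0 < c" using \<nu> K by (simp add: c_def)
    have "invertible_op D"
    proof (rule coercive_imp_invertible_op[OF D])
      show "0 < c\<^sup>2 / k" using c k by simp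
      fix x
      have "c * norm x \<le> norm (D x)"
        using below[of x] K by (simp add: c_def pos_divide_le_eq mult.commute)
      then have "(c * norm x)\<^sup>2 \<le> (norm (D x))\<^sup>2"
        using c by (intro power_mono) auto
      also have "\<dots> \<le> k * rinner (D x) x"
      proof (rule norm_sq_le_form[OF D])
        show "0 \<le> rinner (D y) y" for y using top[of y] by (simp add: Dx rinner_simps)
        show "rinner (D y) y \<le> k * (norm y)\<^sup>2" for y
        proof -
          have "rinner (D y) y \<le> norm D * (norm y)\<^sup>2" using abs_form_le_norm[of D y] by simp
          also have "\<dots> \<le> k * (norm y)\<^sup>2" by (intro mult_right_mono) (auto simp: k_def)
          finally show ?thesis .
        qed
      qed
      finally show "c\<^sup>2 / k * (norm x)\<^sup>2 \<le> rinner (D x) x"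
        using k by (simp add: power_mult_distrib pos_divide_le_eq mult.commute)
    qed
    then show False using \<mu> by (simp add: real_spectrum_iff D_def)
  qed
  have "rinner (T x) x \<le> \<nu> * (norm x)\<^sup>2" by (rule top)
  also have "\<dots> \<le> 1 * (norm x)\<^sup>2" using \<open>\<nu> \<le> 1\<close> by (intro mult_right_mono) auto
  finally show ?thesis by simp
qed

text \<open>Pedersen's argument. With \<open>s = (p + q) / 2\<close>, the hypotheses say that
  \<open>A\<^bsup>-p/2\<^esup> B\<^bsup>p/2\<^esup>\<close> and \<open>B\<^bsup>q/2\<^esup> A\<^bsup>-q/2\<^esup>\<close> are contractions. So is their product
  \<open>Z = A\<^bsup>-p/2\<^esup> B\<^bsup>s\<^esup> A\<^bsup>-q/2\<^esup>\<close>, which is similar to the positive operator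
  \<open>A\<^bsup>-s/2\<^esup> B\<^bsup>s\<^esup> A\<^bsup>-s/2\<^esup>\<close> by means of a power of \<open>A\<close>. The latter is therefore at most \<open>I\<close>,
  and multiplication by \<open>A\<^bsup>s/2\<^esup>\<close> on both sides gives \<open>B\<^sup>s \<le> A\<^sup>s\<close>.\<close>

lemma op_powr_mono_midpoint:
  fixes A B :: "'a::chilbert_space \<Rightarrow>\<^sub>L 'a"
  assumes A: "form_between a b A" and B: "form_between a b B" and a: "0 < a"
    and p: "\<And>x. rinner (op_powr B p x) x \<le> rinner (op_powr A p x) x"
    and q: "\<And>x. rinner (op_powr B q x) x \<le> rinner (op_powr A q x) x"
  shows "rinner (op_powr B ((p + q) / 2) y) y \<le> rinner (op_powr A ((p + q) / 2) y) y"
proof -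
  define P where "P = op_powr A"
  define Q where "Q = op_powr B"
  define s where "s = (p + q) / 2"
  \<comment> \<open>Conjugation by the power \<open>u\<close> of \<open>A\<close> distributes the exponents \<open>p / 2\<close> and \<open>q / 2\<close> evenly.\<close>
  define u where "u = (p - q) / 4"
  have PP: "P r (P t x) = P (r + t) x" for r t x
    unfolding P_def op_powr_add[OF A a] by simp
  have QQ: "Q r (Q t x) = Q (r + t) x" for r t x
    unfolding Q_def op_powr_add[OF B a] by simp
  have P0: "P 0 x = x" for x
    unfolding P_def op_powr_zero[OF A a] by simp
  have Psym: "rinner (P r x) z = rinner x (P r z)" for r x z
    unfolding P_def by (rule selfadjoint_rinner[OF selfadjoint_op_powr[OF A a]])
  have Qsym: "rinner (Q r x) z = rinner x (Q r z)" for r x z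
    unfolding Q_def by (rule selfadjoint_rinner[OF selfadjoint_op_powr[OF B a]])
  have contr: "norm (Q (r / 2) (P (- r / 2) x)) \<le> norm x"
    if r: "\<And>x. rinner (Q r x) x \<le> rinner (P r x) x" for r x
  proof (rule power2_le_imp_le)
    define z where "z = P (- r / 2) x"
    have "(norm (Q (r / 2) z))\<^sup>2 = rinner (Q r z) z"
      by (simp add: rinner_self[symmetric] Qsym[of _ _ "Q (r / 2) z"] QQ rinner_commute)
    also have "\<dots> \<le> rinner (P r z) z" by (rule r)
    also have "\<dots> = (norm x)\<^sup>2"
      by (simp add: z_def PP Psym[symmetric] P0 rinner_self)
    finally show "(norm (Q (r / 2) (P (- r / 2) x)))\<^sup>2 \<le> (norm x)\<^sup>2" by (simp add: z_def)
  qed simp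
  have adj: "norm (P (- r / 2) (Q (r / 2) x)) \<le> norm x"
    if r: "\<And>x. rinner (Q r x) x \<le> rinner (P r x) x" for r x
  proof -
    define w where "w = P (- r / 2) (Q (r / 2) x)"
    have "norm w * norm w = rinner x (Q (r / 2) (P (- r / 2) w))"
      by (simp only: Psym[symmetric] Qsym[symmetric] w_def[symmetric] rinner_self power2_eq_square)
    also have "\<dots> \<le> norm x * norm (Q (r / 2) (P (- r / 2) w))"
      using rinner_Cauchy_Schwarz[of x "Q (r / 2) (P (- r / 2) w)"] by linarith
    also have "\<dots> \<le> norm x * norm w" by (intro mult_left_mono contr r) auto
    finally have "norm w \<le> norm x"
      by (cases "w = 0") (auto intro: mult_right_le_imp_le)
    then show ?thesis by (simp add: w_def)
  qed
  define Z where "Z = P (- p / 2) o\<^sub>L (Q s o\<^sub>L P (- q / 2))"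
  define T where "T = P (- s / 2) o\<^sub>L (Q s o\<^sub>L P (- s / 2))"
  have "selfadjoint T"
  proof -
    have "selfadjoint (P r)" "selfadjoint (Q r)" for r
      unfolding P_def Q_def using selfadjoint_op_powr A B a by blast+
    then show ?thesis unfolding selfadjoint_def bounded_ops_def T_def by simp
  qed
  moreover have "P (- u) (T x) = Z (P (- u) x)" for x
  proof -
    have "- u + - s / 2 = - p / 2" "- q / 2 + - u = - s / 2"
      by (simp_all add: u_def s_def field_simps)
    then show ?thesis by (simp add: T_def Z_def PP)
  qed
  moreover have "P u (P (- u) x) = x" for x by (simp add: PP P0)
  moreover have "norm (Z x) \<le> norm x" for x
  proof -
    have "p / 2 + q / 2 = s" by (simp add: s_def)
    then have "Z x = P (- p / 2) (Q (p / 2) (Q (q / 2) (P (- q / 2) x)))"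
      by (simp add: Z_def QQ)
    also have "norm \<dots> \<le> norm (Q (q / 2) (P (- q / 2) x))" by (rule adj) (simp add: P_def Q_def p)
    also have "\<dots> \<le> norm x" by (rule contr) (simp add: P_def Q_def q)
    finally show ?thesis .
  qed
  ultimately have T: "rinner (T x) x \<le> (norm x)\<^sup>2" for x
    by (rule form_le_of_similar_contraction)
  have "rinner (Q s y) y = rinner (T (P (s / 2) y)) (P (s / 2) y)"
    by (simp add: T_def Psym[symmetric] PP P0)
  also have "\<dots> \<le> (norm (P (s / 2) y))\<^sup>2" by (rule T)
  also have "\<dots> = rinner (P s y) y"
    by (simp add: rinner_self[symmetric] Psym[symmetric] PP)
  finally show ?thesis by (simp add: P_def Q_def s_def)
qed

text \<open>The function \<open>(r, t) \<mapsto> t\<^sup>r\<close> is uniformly continuous on the compact rectangle, so nearby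
  exponents give uniformly close functions on the spectrum.\<close>

lemma continuous_on_op_powr_form:
  assumes T: "form_between a b T" and a: "0 < a"
  shows "continuous_on {0..1} (\<lambda>r. rinner (op_powr T r x) x)"
  unfolding continuous_on_iff
proof (intro ballI allI impI)
  fix r e :: real assume r: "r \<in> {0..1}" and e: "0 < e"
  define \<eta> where "\<eta> = e / ((norm x)\<^sup>2 + 1)"
  have "0 < (norm x)\<^sup>2 + 1" by (simp add: add_nonneg_pos)
  then have \<eta>: "0 < \<eta>" "\<eta> * (norm x)\<^sup>2 < e"
    using e by (simp_all add: \<eta>_def field_simps)
  have "continuous_on ({0..1} \<times> {a..b}) (\<lambda>z. snd z powr fst z)"
    by (rule continuous_on_powr) (use a in \<open>auto intro!: continuous_on_snd continuous_on_fst continuous_on_id\<close>)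
  then have "uniformly_continuous_on ({0..1} \<times> {a..b}) (\<lambda>z. snd z powr fst z)"
    by (rule compact_uniformly_continuous) (intro compact_Times compact_Icc)
  then obtain d where d: "0 < d" and unif: "\<And>z z'. z \<in> {0..1} \<times> {a..b} \<Longrightarrow> z' \<in> {0..1} \<times> {a..b} \<Longrightarrow>
      dist z' z < d \<Longrightarrow> dist (snd z' powr fst z') (snd z powr fst z) < \<eta>"
    using \<eta>(1) unfolding uniformly_continuous_on_def by meson
  have half: "rinner (op_powr T v x) x \<le> rinner (op_powr T w x) x + \<eta> * (norm x)\<^sup>2"
    if v: "v \<in> {0..1}" and w: "w \<in> {0..1}" and vw: "dist v w < d" for v w
  proof -
    have "rinner (op_powr T v x) x \<le> rinner (fun_calc (\<lambda>t. 1 * t powr w + \<eta>) T x) x"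
      unfolding op_powr_def
    proof (rule fun_calc_mono[OF T])
      fix t assume "t \<in> {a..b}"
      then have "dist (t powr v) (t powr w) < \<eta>"
        using unif[of "(w, t)" "(v, t)"] v w vw by (simp add: dist_Pair_Pair)
      then show "t powr v \<le> 1 * t powr w + \<eta>" by (simp add: dist_real_def)
    qed (intro continuous_on_add continuous_on_mult continuous_on_const continuous_on_powr_pos a)+
    also have "\<dots> = rinner (op_powr T w x) x + \<eta> * (norm x)\<^sup>2"
      unfolding op_powr_def using fun_calc_affine[OF T continuous_on_powr_pos[OF a], of 1 w \<eta> x] by simp
    finally show ?thesis .
  qed
  show "\<exists>d>0. \<forall>r'\<in>{0..1}. dist r' r < d \<longrightarrow>
      dist (rinner (op_powr T r' x) x) (rinner (op_powr T r x) x) < e"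
  proof (intro exI[of _ d] conjI ballI impI d)
    fix r' :: real assume r': "r' \<in> {0..1}" "dist r' r < d"
    show "dist (rinner (op_powr T r' x) x) (rinner (op_powr T r x) x) < e"
      using half[OF r'(1) r r'(2)] half[OF r r'(1)] r'(2) \<eta>(2)
      by (simp add: dist_real_def abs_minus_commute abs_less_iff)
  qed
qed

text \<open>A point outside such a set would lie in a gap, whose endpoints have their midpoint in
  the set.\<close>

lemma midpoint_closed_set_contains_interval:
  fixes E :: "real set"
  assumes E: "closed E" and a: "a \<in> E" and b: "b \<in> E"
    and mid: "\<And>x y. x \<in> E \<Longrightarrow> y \<in> E \<Longrightarrow> (x + y) / 2 \<in> E"
  shows "{a..b} \<subseteq> E"
proof
  fix r assume r: "r \<in> {a..b}"
  show "r \<in> E"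
  proof (rule ccontr)
    assume nr: "r \<notin> E"
    define l where "l = Sup (E \<inter> {a..r})"
    define h where "h = Inf (E \<inter> {r..b})"
    have "l \<in> E \<inter> {a..r}" unfolding l_def
      using a r E by (intro closed_contains_Sup) (auto intro: bdd_aboveI[of _ r])
    moreover have "h \<in> E \<inter> {r..b}" unfolding h_def
      using b r E by (intro closed_contains_Inf) (auto intro: bdd_belowI[of _ r])
    moreover have "l \<noteq> r" "h \<noteq> r" using calculation nr by auto
    ultimately have l: "l \<in> E" "a \<le> l" "l < r" and h: "h \<in> E" "r < h" "h \<le> b" by auto
    define c where "c = (l + h) / 2"
    have c: "c \<in> E" "l < c" "c < h" using mid[OF l(1) h(1)] l h by (auto simp: c_def)
    show False
    proof (cases "c \<le> r")
      case True
      then have "c \<le> l" unfolding l_def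
        using c l by (intro cSup_upper) (auto intro: bdd_aboveI[of _ r])
      with c show False by simp
    next
      case False
      then have "h \<le> c" unfolding h_def
        using c h by (intro cInf_lower) (auto intro: bdd_belowI[of _ r])
      with c show False by simp
    qed
  qed
qed

text \<open>The exponents for which the inequality holds form a closed set that contains \<open>0\<close> and \<open>1\<close>
  and is closed under midpoints.\<close>

lemma Loewner_Heinz_invertible:
  fixes A B :: "'a::chilbert_space \<Rightarrow>\<^sub>L 'a"
  assumes A: "form_between a b A" and B: "form_between a b B" and a: "0 < a"
    and le: "\<And>x. rinner (B x) x \<le> rinner (A x) x" and r: "0 \<le> r" "r \<le> 1"
  shows "rinner (op_powr B r x) x \<le> rinner (op_powr A r x) x"
proof -
  define E where "E = {r \<in> {0..1}. \<forall>x. rinner (op_powr B r x) x \<le> rinner (op_powr A r x) x}"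
  have "{0..1} \<subseteq> E"
  proof (rule midpoint_closed_set_contains_interval)
    have "E = (\<Inter>x. {r \<in> {0..1}. rinner (op_powr B r x) x \<le> rinner (op_powr A r x) x})"
      by (auto simp: E_def)
    moreover have "closed {r \<in> {0..1}. rinner (op_powr B r x) x \<le> rinner (op_powr A r x) x}" for x
      by (intro continuous_on_closed_Collect_le continuous_on_op_powr_form[OF A a]
          continuous_on_op_powr_form[OF B a]) auto
    ultimately show "closed E" by auto
    show "0 \<in> E" by (simp add: E_def op_powr_zero[OF A a] op_powr_zero[OF B a])
    show "1 \<in> E" by (simp add: E_def op_powr_one[OF A a] op_powr_one[OF B a] le)
    show "(v + w) / 2 \<in> E" if "v \<in> E" "w \<in> E" for v w
      using that op_powr_mono_midpoint[OF A B a, of v w] by (auto simp: E_def)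
  qed
  with r show ?thesis by (auto simp: E_def)
qed

text \<open>The operators are shifted by \<open>\<epsilon>\<close> to make them invertible; subadditivity of the power
  controls the error.\<close>

theorem Loewner_Heinz:
  fixes A B :: "'a::chilbert_space \<Rightarrow>\<^sub>L 'a"
  assumes A: "form_between 0 b A" and B: "form_between 0 b B"
    and le: "\<And>x. rinner (B x) x \<le> rinner (A x) x" and r: "0 < r" "r \<le> 1"
  shows "rinner (op_powr B r x) x \<le> rinner (op_powr A r x) x"
proof (rule field_le_epsilon)
  fix e :: real assume e: "0 < e"
  define \<eta> where "\<eta> = e / ((norm x)\<^sup>2 + 1)"
  have "0 < (norm x)\<^sup>2 + 1" by (simp add: add_nonneg_pos)
  then have \<eta>: "0 < \<eta>" "\<eta> * (norm x)\<^sup>2 \<le> e"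
    using e by (simp_all add: \<eta>_def field_simps)
  define \<epsilon> where "\<epsilon> = \<eta> powr (1 / r)"
  have \<epsilon>: "0 < \<epsilon>" "\<epsilon> powr r = \<eta>" using \<eta> r by (simp_all add: \<epsilon>_def powr_powr)
  have cont: "continuous_on {0..b} (\<lambda>t. t powr r)"
    using r by (intro continuous_on_powr_nonneg) auto
  have cont_shift: "continuous_on {0..b} (\<lambda>t. (t + \<epsilon>) powr r)"
    by (rule continuous_on_powr) (use \<epsilon> in \<open>auto intro!: continuous_intros\<close>)
  have shift: "op_powr (T + \<epsilon> *\<^sub>R id_blinfun) r = fun_calc (\<lambda>t. (t + \<epsilon>) powr r) T"
    if "form_between 0 b T" for T :: "'a \<Rightarrow>\<^sub>L 'a"
    unfolding op_powr_def
    by (rule fun_calc_shift[OF that]) (use \<epsilon> in \<open>auto intro: continuous_on_powr_pos\<close>)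
  have "rinner (op_powr B r x) x \<le> rinner (op_powr (B + \<epsilon> *\<^sub>R id_blinfun) r x) x"
    unfolding shift[OF B] unfolding op_powr_def
    by (rule fun_calc_mono[OF B cont cont_shift]) (use \<epsilon> r in \<open>auto intro: powr_mono2\<close>)
  also have "\<dots> \<le> rinner (op_powr (A + \<epsilon> *\<^sub>R id_blinfun) r x) x"
  proof (rule Loewner_Heinz_invertible)
    show "form_between (0 + \<epsilon>) (b + \<epsilon>) (A + \<epsilon> *\<^sub>R id_blinfun)" by (rule form_between_shift[OF A])
    show "form_between (0 + \<epsilon>) (b + \<epsilon>) (B + \<epsilon> *\<^sub>R id_blinfun)" by (rule form_between_shift[OF B])
    show "rinner ((B + \<epsilon> *\<^sub>R id_blinfun) y) y \<le> rinner ((A + \<epsilon> *\<^sub>R id_blinfun) y) y" for y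
      using le[of y] by (simp add: rinner_simps)
  qed (use \<epsilon> r in auto)
  also have "\<dots> \<le> rinner (fun_calc (\<lambda>t. 1 * t powr r + \<eta>) A x) x"
    unfolding shift[OF A]
  proof (rule fun_calc_mono[OF A cont_shift])
    show "continuous_on {0..b} (\<lambda>t. 1 * t powr r + \<eta>)"
      by (intro continuous_on_add continuous_on_mult continuous_on_const cont)
    show "(t + \<epsilon>) powr r \<le> 1 * t powr r + \<eta>" if "t \<in> {0..b}" for t
      using powr_subadditive[of t \<epsilon> r] that \<epsilon> r by simp
  qed
  also have "\<dots> = rinner (op_powr A r x) x + \<eta> * (norm x)\<^sup>2"
    unfolding op_powr_def using fun_calc_affine[OF A cont, of 1 \<eta> x] by simp
  finally show "rinner (op_powr B r x) x \<le> rinner (op_powr A r x) x + e"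
    using \<eta>(2) by linarith
qed

section \<open>The gap between powers and logarithms\<close>

text \<open>The general form of the estimate: \<open>B \<le> A - m\<close>, so \<open>B\<^sup>r \<le> (A - m)\<^sup>r\<close> by the
  Loewner--Heinz inequality, and \<open>A\<^sup>r - (A - m)\<^sup>r\<close> is a function of \<open>A\<close> alone. That function is
  decreasing, so its values are bounded below by the one at the upper bound of \<open>A\<close>.\<close>

lemma op_powr_gap:
  fixes A B :: "'a::chilbert_space \<Rightarrow>\<^sub>L 'a"
  assumes A: "form_between m b A" and B: "form_between 0 (b - m) B" and m: "0 \<le> m"
    and gap: "\<And>x. m * (norm x)\<^sup>2 \<le> rinner (A x) x - rinner (B x) x"
    and r: "0 < r" "r \<le> 1"
  shows "(b powr r - (b - m) powr r) * (norm x)\<^sup>2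
    \<le> rinner (op_powr A r x) x - rinner (op_powr B r x) x"
proof -
  define C where "C = A + (- m) *\<^sub>R id_blinfun"
  have C: "form_between 0 (b - m) C"
    using form_between_shift[OF A, of "- m"] by (simp add: C_def)
  have "rinner (B y) y \<le> rinner (C y) y" for y
    using gap[of y] by (simp add: C_def rinner_simps)
  then have BC: "rinner (op_powr B r x) x \<le> rinner (op_powr C r x) x"
    by (rule Loewner_Heinz[OF C B _ r])
  have contA: "continuous_on {m..b} (\<lambda>t. t powr r)"
    using m r by (intro continuous_on_powr_nonneg) auto
  have contC: "continuous_on {m..b} (\<lambda>t. (t - m) powr r)"
    by (rule continuous_on_powr') (use r in \<open>auto intro: continuous_on_diff continuous_on_id continuous_on_const\<close>)
  have "op_powr C r = fun_calc (\<lambda>t. (t + - m) powr r) A"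
    unfolding op_powr_def C_def
    by (rule fun_calc_shift[OF A]) (use r in \<open>auto intro: continuous_on_powr_nonneg\<close>)
  then have Cr: "op_powr C r = fun_calc (\<lambda>t. (t - m) powr r) A" by simp
  have "(b powr r - (b - m) powr r) * (norm x)\<^sup>2
      = rinner (fun_calc (\<lambda>t. b powr r - (b - m) powr r) A x) x"
    using fun_calc_poly[OF A, of "\<lambda>t. b powr r - (b - m) powr r" "[:b powr r - (b - m) powr r:]"]
    by (simp add: op_poly_const rinner_simps)
  also have "\<dots> \<le> rinner (fun_calc (\<lambda>t. t powr r - (t - m) powr r) A x) x"
    by (rule fun_calc_mono[OF A continuous_on_const continuous_on_diff[OF contA contC]])
       (use m r in \<open>auto intro: powr_increment_antimono\<close>)
  also have "\<dots> = rinner (op_powr A r x) x - rinner (op_powr C r x) x"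
    unfolding fun_calc_diff[OF A contA contC] Cr unfolding op_powr_def by (simp add: rinner_simps)
  finally show ?thesis using BC by linarith
qed

lemma ln_le_powr_quotient:
  fixes t r :: real
  assumes "0 < t" "0 < r" shows "ln t \<le> (t powr r - 1) / r"
proof -
  have "ln (t powr r) \<le> t powr r - 1" using assms by (intro ln_le_minus_one) simp
  then show ?thesis using assms by (simp add: field_simps)
qed

text \<open>With \<open>y = r ln t\<close> this is \<open>e\<^sup>y \<le> 1 + y + 2 y\<^sup>2\<close> for \<open>y \<le> 1 / 2\<close>, which follows from
  \<open>e\<^sup>y \<le> 1 / (1 - y)\<close>.\<close>

lemma powr_quotient_le_ln:
  fixes t r L :: real
  assumes t: "0 < t" "\<bar>ln t\<bar> \<le> L" and r: "0 < r" "r * L \<le> 1 / 2"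
  shows "(t powr r - 1) / r \<le> ln t + 2 * L\<^sup>2 * r"
proof -
  define y where "y = r * ln t"
  have "\<bar>y\<bar> \<le> r * L" using t r by (simp add: y_def abs_mult)
  then have y: "y \<le> 1 / 2" and y2: "y\<^sup>2 \<le> (r * L)\<^sup>2"
    using r by (auto intro: order_trans[OF _ power_mono[of "\<bar>y\<bar>" _ 2, simplified]])
  have "exp y * (1 - y) \<le> exp y * exp (- y)"
    using exp_ge_add_one_self[of "- y"] by (intro mult_left_mono) auto
  then have "exp y * (1 - y) \<le> 1" by (simp add: exp_minus)
  also have "1 \<le> (1 + y + 2 * y\<^sup>2) * (1 - y)"
  proof -
    have "0 \<le> y\<^sup>2 * (1 - 2 * y)" using y by simp
    then show ?thesis by (simp add: power2_eq_square algebra_simps)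
  qed
  finally have "exp y \<le> 1 + y + 2 * y\<^sup>2" using y by simp
  then have "t powr r - 1 \<le> y + 2 * (r * L)\<^sup>2"
    using y2 t by (simp add: powr_def y_def)
  also have "\<dots> = (ln t + 2 * L\<^sup>2 * r) * r"
    by (simp add: y_def power2_eq_square algebra_simps)
  finally show ?thesis using r by (simp add: pos_divide_le_eq)
qed

text \<open>Two scalar estimates give a bound that holds also when \<open>B\<close> is not invertible:
  \<open>ln s \<le> (s\<^sup>r - 1) / r\<close> at \<open>s = max \<epsilon> t\<close>, and \<open>(max \<epsilon> t)\<^sup>r \<le> t\<^sup>r + \<epsilon>\<^sup>r\<close>, where \<open>\<epsilon>\<^sup>r\<close> tends
  to \<open>0\<close>.\<close>

lemma log_form_le_op_powr:
  fixes B :: "'a::chilbert_space \<Rightarrow>\<^sub>L 'a"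
  assumes B: "form_between 0 b B" and r: "0 < r"
  shows "log_form B x \<le> ereal ((rinner (op_powr B r x) x - (norm x)\<^sup>2) / r)"
proof -
  define \<beta> where "\<beta> = (rinner (op_powr B r x) x - (norm x)\<^sup>2) / r"
  have bound: "log_form B x \<le> ereal (\<beta> + \<eta> * ((norm x)\<^sup>2 / r))" if \<eta>: "0 < \<eta>" for \<eta>
  proof -
    define \<epsilon> where "\<epsilon> = \<eta> powr (1 / r)"
    have \<epsilon>: "0 < \<epsilon>" "\<epsilon> powr r = \<eta>" using \<eta> r by (simp_all add: \<epsilon>_def powr_powr)
    have cont: "continuous_on {0..b} (\<lambda>t. t powr r)"
      using r by (intro continuous_on_powr_nonneg) auto
    have cont_ln: "continuous_on {0..b} (\<lambda>t. ln (max \<epsilon> t))"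
      by (rule continuous_on_ln) (use \<epsilon> in \<open>auto intro!: continuous_on_max continuous_on_id continuous_on_const\<close>)
    have "log_form B x \<le> ereal (rinner (fun_calc (\<lambda>t. ln (max \<epsilon> t)) B x) x)"
      unfolding log_form_def rinner_def by (rule INF_lower) (use \<epsilon> in simp)
    also have "rinner (fun_calc (\<lambda>t. ln (max \<epsilon> t)) B x) x
        \<le> rinner (fun_calc (\<lambda>t. 1 / r * t powr r + (\<eta> - 1) / r) B x) x"
    proof (rule fun_calc_mono[OF B cont_ln])
      show "continuous_on {0..b} (\<lambda>t. 1 / r * t powr r + (\<eta> - 1) / r)"
        by (intro continuous_on_add continuous_on_mult continuous_on_const cont)
      fix t assume "t \<in> {0..b}"
      have "ln (max \<epsilon> t) \<le> (max \<epsilon> t powr r - 1) / r"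
        using \<epsilon> r by (intro ln_le_powr_quotient) auto
      also have "max \<epsilon> t powr r \<le> t powr r + \<epsilon> powr r" by (cases "\<epsilon> \<le> t") (auto simp: max_def)
      finally show "ln (max \<epsilon> t) \<le> 1 / r * t powr r + (\<eta> - 1) / r"
        using r \<epsilon> by (simp add: add_divide_distrib diff_divide_distrib divide_right_mono)
    qed
    also have "\<dots> = \<beta> + \<eta> * ((norm x)\<^sup>2 / r)"
      unfolding fun_calc_affine[OF B cont] using r by (simp add: \<beta>_def op_powr_def field_simps)
    finally show ?thesis by simp
  qed
  have "((\<lambda>\<eta>. ereal (\<beta> + \<eta> * ((norm x)\<^sup>2 / r))) \<longlongrightarrow> ereal (\<beta> + 0 * ((norm x)\<^sup>2 / r))) (at_right 0)"
    by (intro tendsto_intros)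
  then have "log_form B x \<le> ereal (\<beta> + 0 * ((norm x)\<^sup>2 / r))"
  proof (rule tendsto_lowerbound)
    show "\<forall>\<^sub>F \<eta> in at_right 0. log_form B x \<le> ereal (\<beta> + \<eta> * ((norm x)\<^sup>2 / r))"
      unfolding eventually_at_right_field using bound zero_less_one by blast
  qed simp
  then show ?thesis by (simp add: \<beta>_def)
qed

lemma continuous_on_ln_interval:
  fixes a b :: real assumes "0 < a" shows "continuous_on {a..b} ln"
  by (rule continuous_on_ln[OF continuous_on_id]) (use assms in auto)

text \<open>Conversely, on an interval away from \<open>0\<close> the quotient \<open>(t\<^sup>r - 1) / r\<close> exceeds \<open>ln t\<close> by
  at most a multiple of \<open>r\<close>, uniformly in \<open>t\<close>.\<close>

lemma op_powr_le_op_log: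
  fixes A :: "'a::chilbert_space \<Rightarrow>\<^sub>L 'a"
  assumes A: "form_between a b A" and a: "0 < a" and r: "0 < r" "r * (\<bar>ln a\<bar> + \<bar>ln b\<bar>) \<le> 1 / 2"
  shows "(rinner (op_powr A r x) x - (norm x)\<^sup>2) / r
    \<le> rinner (op_log A x) x + 2 * (\<bar>ln a\<bar> + \<bar>ln b\<bar>)\<^sup>2 * r * (norm x)\<^sup>2"
proof -
  define L where "L = \<bar>ln a\<bar> + \<bar>ln b\<bar>"
  have cont: "continuous_on {a..b} (\<lambda>t. t powr r)" by (rule continuous_on_powr_pos[OF a])
  have ln: "continuous_on {a..b} ln" by (rule continuous_on_ln_interval[OF a])
  have "(rinner (op_powr A r x) x - (norm x)\<^sup>2) / r
      = rinner (fun_calc (\<lambda>t. 1 / r * t powr r + - 1 / r) A x) x"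
    unfolding fun_calc_affine[OF A cont] op_powr_def using r by (simp add: field_simps)
  also have "\<dots> \<le> rinner (fun_calc (\<lambda>t. 1 * ln t + 2 * L\<^sup>2 * r) A x) x"
  proof (rule fun_calc_mono[OF A])
    fix t assume t: "t \<in> {a..b}"
    then have "ln a \<le> ln t" "ln t \<le> ln b" using a by auto
    then have "\<bar>ln t\<bar> \<le> L" by (auto simp: L_def)
    then have "(t powr r - 1) / r \<le> ln t + 2 * L\<^sup>2 * r"
      using t a r by (intro powr_quotient_le_ln) (auto simp: L_def)
    then show "1 / r * t powr r + - 1 / r \<le> 1 * ln t + 2 * L\<^sup>2 * r"
      by (simp add: diff_divide_distrib)
  qed (intro continuous_on_add continuous_on_mult continuous_on_const cont ln)+
  also have "\<dots> = rinner (op_log A x) x + 2 * L\<^sup>2 * r * (norm x)\<^sup>2"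
    unfolding fun_calc_affine[OF A ln] op_log_def by simp
  finally show ?thesis by (simp add: L_def)
qed

text \<open>The logarithm is the derivative of \<open>r \<mapsto> t\<^sup>r\<close> at \<open>0\<close>, so the gap between the logarithms
  is the limit, as \<open>r\<close> tends to \<open>0\<close>, of the gap between the powers divided by \<open>r\<close>.\<close>

lemma log_form_gap:
  fixes A B :: "'a::chilbert_space \<Rightarrow>\<^sub>L 'a"
  assumes A: "form_between m b A" and B: "form_between 0 (b - m) B" and m: "0 < m" "m < b"
    and gap: "\<And>x. m * (norm x)\<^sup>2 \<le> rinner (A x) x - rinner (B x) x"
  shows "log_form B x \<le> ereal (rinner (op_log A x) x - (ln b - ln (b - m)) * (norm x)\<^sup>2)"
proof -
  define L where "L = \<bar>ln m\<bar> + \<bar>ln b\<bar>"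
  define w where "w = (\<lambda>r. b powr r - (b - m) powr r)"
  define g where "g = (\<lambda>r. rinner (op_log A x) x + 2 * L\<^sup>2 * r * (norm x)\<^sup>2 - w r / r * (norm x)\<^sup>2)"
  \<comment> \<open>The bound on \<open>r\<close> ensures both \<open>r \<le> 1\<close> and \<open>r L \<le> 1 / 2\<close>.\<close>
  have bound: "log_form B x \<le> ereal (g r)" if r: "0 < r" "r < 1 / (2 * L + 1)" for r
  proof -
    have "0 \<le> L" by (simp add: L_def)
    then have "r * (2 * L + 1) < 1" using r by (simp add: field_simps)
    moreover have "0 \<le> r * L" using r \<open>0 \<le> L\<close> by simp
    moreover have "r * (2 * L + 1) = 2 * (r * L) + r" by (simp add: algebra_simps)
    ultimately have rL: "r * L \<le> 1 / 2" and r1: "r \<le> 1"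
      using r by linarith+
    have "log_form B x \<le> ereal ((rinner (op_powr B r x) x - (norm x)\<^sup>2) / r)"
      by (rule log_form_le_op_powr[OF B r(1)])
    also have "(rinner (op_powr B r x) x - (norm x)\<^sup>2) / r
        \<le> (rinner (op_powr A r x) x - w r * (norm x)\<^sup>2 - (norm x)\<^sup>2) / r"
      using op_powr_gap[OF A B _ gap r(1) r1, of x] m r
      by (intro divide_right_mono) (auto simp: w_def)
    also have "\<dots> = (rinner (op_powr A r x) x - (norm x)\<^sup>2) / r - w r / r * (norm x)\<^sup>2"
      by (simp add: diff_divide_distrib)
    also have "\<dots> \<le> g r"
      using op_powr_le_op_log[OF A m(1) r(1), of x] rL by (simp add: g_def L_def)
    finally show ?thesis by simp
  qed
  have "(w has_real_derivative (ln b - ln (b - m))) (at 0)"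
    unfolding w_def using m by (auto intro!: derivative_eq_intros)
  then have "((\<lambda>r. w r / r) \<longlongrightarrow> ln b - ln (b - m)) (at 0)"
    using m by (simp add: DERIV_def w_def)
  then have "((\<lambda>r. w r / r) \<longlongrightarrow> ln b - ln (b - m)) (at_right 0)"
    by (rule filterlim_mono) (auto intro: at_le)
  then have "((\<lambda>r. ereal (g r)) \<longlongrightarrow> ereal (rinner (op_log A x) x + 2 * L\<^sup>2 * 0 * (norm x)\<^sup>2
      - (ln b - ln (b - m)) * (norm x)\<^sup>2)) (at_right 0)"
    unfolding g_def by (intro tendsto_intros)
  then have "log_form B x \<le> ereal (rinner (op_log A x) x + 2 * L\<^sup>2 * 0 * (norm x)\<^sup>2
      - (ln b - ln (b - m)) * (norm x)\<^sup>2)"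
  proof (rule tendsto_lowerbound)
    have "0 < 1 / (2 * L + 1)" by (simp add: L_def add_nonneg_pos)
    then show "\<forall>\<^sub>F r in at_right 0. log_form B x \<le> ereal (g r)"
      using bound unfolding eventually_at_right_field by blast
  qed simp
  then show ?thesis by simp
qed

text \<open>The borderline case \<open>m = \<parallel>A\<parallel>\<close>, in which \<open>B\<close> vanishes and both sides of the logarithmic
  inequality are infinite.\<close>

lemma log_form_zero_operator:
  fixes B :: "'a::chilbert_space \<Rightarrow>\<^sub>L 'a"
  assumes B: "form_between 0 0 B" and x: "x \<noteq> 0"
  shows "log_form B x = - \<infinity>"
proof -
  have "log_form B x \<le> ereal M" for M
  proof -
    define \<epsilon> where "\<epsilon> = exp (M / (norm x)\<^sup>2)"
    have "log_form B x \<le> ereal (rinner (fun_calc (\<lambda>t. ln (max \<epsilon> t)) B x) x)"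
      unfolding log_form_def rinner_def by (rule INF_lower) (simp add: \<epsilon>_def)
    also have "fun_calc (\<lambda>t. ln (max \<epsilon> t)) B = op_poly [:M / (norm x)\<^sup>2:] B"
      by (rule fun_calc_poly[OF B]) (simp add: \<epsilon>_def max_def)
    also have "rinner (op_poly [:M / (norm x)\<^sup>2:] B x) x = M"
      using x by (simp add: op_poly_const rinner_simps)
    finally show ?thesis .
  qed
  then show ?thesis by (metis ereal_bot)
qed

lemma op_log_le_log_form:
  fixes B :: "'a::chilbert_space \<Rightarrow>\<^sub>L 'a"
  assumes B: "form_between a b B" and a: "0 < a"
  shows "ereal (rinner (op_log B x) x) \<le> log_form B x"
  unfolding log_form_def rinner_def[symmetric] op_log_def
proof (rule INF_greatest)
  fix \<epsilon> :: real assume "\<epsilon> \<in> {0<..}"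
  then have \<epsilon>: "0 < \<epsilon>" by simp
  have "rinner (fun_calc ln B x) x \<le> rinner (fun_calc (\<lambda>t. ln (max \<epsilon> t)) B x) x"
  proof (rule fun_calc_mono[OF B continuous_on_ln_interval[OF a]])
    show "continuous_on {a..b} (\<lambda>t. ln (max \<epsilon> t))"
      by (rule continuous_on_ln) (use \<epsilon> in \<open>auto intro!: continuous_on_max continuous_on_id continuous_on_const\<close>)
    show "ln t \<le> ln (max \<epsilon> t)" if "t \<in> {a..b}" for t
      using that a \<epsilon> by simp
  qed
  then show "ereal (rinner (fun_calc ln B x) x) \<le> ereal (rinner (fun_calc (\<lambda>t. ln (max \<epsilon> t)) B x) x)"
    by simp
qed

section \<open>The operator inequalities\<close>

lemma op_le_iff_rinner:
  "T \<le>\<^sub>o\<^sub>p S \<longleftrightarrow> selfadjoint T \<and> selfadjoint S \<and> (\<forall>x. rinner (T x) x \<le> rinner (S x) x)"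
  by (simp add: op_le_def rinner_def)

lemma selfadjoint_trivial_space:
  fixes T :: "'a::chilbert_space \<Rightarrow>\<^sub>L 'a"
  assumes "\<And>x::'a. x = 0"
  shows "selfadjoint T"
proof -
  have "T = 0" by (rule blinfun_eqI) (metis assms)
  then show ?thesis by (simp add: selfadjoint_zero)
qed

theorem corollary2p5:
  fixes A B :: "'a::chilbert_space \<Rightarrow>\<^sub>L 'a"
  assumes "A \<in> bounded_ops" and "B \<in> bounded_ops"
    and "B <\<^sub>o\<^sub>p A" and "0 \<le>\<^sub>o\<^sub>p B"
  shows "(\<forall>r::real. 0 < r \<and> r \<le> 1 \<longrightarrow>
            (norm A powr r - (norm A - 1 / norm (inverse_op (A - B))) powr r) *\<^sub>R id_blinfun
              \<le>\<^sub>o\<^sub>p op_powr A r - op_powr B r)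
       \<and> (invertible_op B \<longrightarrow>
            (ln (norm A) - ln (norm A - 1 / norm (inverse_op (A - B)))) *\<^sub>R id_blinfun
              \<le>\<^sub>o\<^sub>p op_log A - op_log B)
       \<and> (\<forall>x. (ln_ereal (norm A) - ln_ereal (norm A - 1 / norm (inverse_op (A - B))))
                * ereal ((norm x)\<^sup>2)
              \<le> ereal (Re (cinner (op_log A x) x)) - log_form B x)"
proof -
  define N where "N = norm A"
  define m where "m = 1 / norm (inverse_op (A - B))"
  have sA: "selfadjoint A" and sB: "selfadjoint B" and inv: "invertible_op (A - B)"
    and AB: "\<And>x. rinner (B x) x \<le> rinner (A x) x"
    using assms(3) by (auto simp: op_less_def op_le_iff_rinner)
  have B0: "0 \<le> rinner (B x) x" for x
    using assms(4) by (simp add: op_le_iff_rinner rinner_zero_left)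
  have m0: "0 \<le> m" by (simp add: m_def)
  have gap: "m * (norm x)\<^sup>2 \<le> rinner (A x) x - rinner (B x) x" for x
    using positive_inverse_lower_bound[OF selfadjoint_diff[OF sA sB] _ is_inverse_op_inverse_op[OF inv], of x]
      AB by (simp add: m_def rinner_simps)
  have AN: "rinner (A x) x \<le> N * (norm x)\<^sup>2" for x
    using abs_form_le_norm[of A x] by (simp add: N_def)
  have A: "form_between m N A"
    unfolding form_between_def
  proof (intro conjI allI sA AN)
    show "m * (norm x)\<^sup>2 \<le> rinner (A x) x" for x using gap[of x] B0[of x] by simp
  qed
  have B: "form_between 0 (N - m) B"
    unfolding form_between_def
  proof (intro conjI allI sB)
    show "0 * (norm x)\<^sup>2 \<le> rinner (B x) x" for x using B0[of x] by simp
    show "rinner (B x) x \<le> (N - m) * (norm x)\<^sup>2" for x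
      using gap[of x] AN[of x] by (simp add: algebra_simps)
  qed
  have powers: "(N powr r - (N - m) powr r) *\<^sub>R id_blinfun \<le>\<^sub>o\<^sub>p op_powr A r - op_powr B r"
    if r: "0 < r" "r \<le> 1" for r
    unfolding op_le_iff_rinner
  proof (intro conjI allI)
    have "selfadjoint (op_powr A r)" unfolding op_powr_def
      by (rule selfadjoint_fun_calc[OF A continuous_on_powr_nonneg[OF m0 r(1)]])
    moreover have "selfadjoint (op_powr B r)" unfolding op_powr_def
      by (rule selfadjoint_fun_calc[OF B continuous_on_powr_nonneg[OF order_refl r(1)]])
    ultimately show "selfadjoint (op_powr A r - op_powr B r)" by (rule selfadjoint_diff)
    show "rinner (((N powr r - (N - m) powr r) *\<^sub>R id_blinfun) x) x
        \<le> rinner ((op_powr A r - op_powr B r) x) x" for x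
      using op_powr_gap[OF A B m0 gap r, of x] by (simp add: rinner_simps)
  qed (intro selfadjoint_scaleR selfadjoint_id)
  have positive: "0 < m" "m \<le> N" if "x \<noteq> 0" for x :: 'a
  proof -
    have "inverse_op (A - B) ((A - B) x) = x"
      using is_inverse_op_inverse_op[OF inv]
      by (auto simp: is_inverse_op_def dest: arg_cong[where f="\<lambda>f. blinfun_apply f x"])
    then have "inverse_op (A - B) \<noteq> 0" using that by (auto simp: blinfun.zero_left)
    then show "0 < m" by (simp add: m_def)
    have "m * (norm x)\<^sup>2 \<le> N * (norm x)\<^sup>2" using gap[of x] B0[of x] AN[of x] by linarith
    then show "m \<le> N" using that by simp
  qed
  have logs: "(ln_ereal N - ln_ereal (N - m)) * ereal ((norm x)\<^sup>2)
      \<le> ereal (rinner (op_log A x) x) - log_form B x" for x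
  proof -
    consider "x = 0" | "x \<noteq> 0" "N = m" | "x \<noteq> 0" "0 < m" "m < N"
      using positive[of x] by fastforce
    then show ?thesis
    proof cases
      case 1
      \<comment> \<open>The product with \<open>0\<close> is \<open>0\<close>, whether or not the difference of logarithms is finite.\<close>
      have "log_form B 0 = 0" unfolding log_form_def rinner_def[symmetric]
        by (simp add: rinner_zero_right)
      with 1 show ?thesis by (simp add: rinner_zero_right zero_ereal_def[symmetric])
    next
      case 2
      then have "log_form B x = - \<infinity>" using B by (intro log_form_zero_operator) auto
      then show ?thesis by simp
    next
      case 3
      then show ?thesis
        using log_form_gap[OF A B 3(2,3) gap, of x]
        by (cases "log_form B x") (auto simp: ln_ereal_def)
    qed
  qed
  have invertible_logs: "(ln N - ln (N - m)) *\<^sub>R id_blinfun \<le>\<^sub>o\<^sub>p op_log A - op_log B"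
    if iB: "invertible_op B"
    unfolding op_le_iff_rinner
  proof (cases "\<forall>x::'a. x = 0")
    \<comment> \<open>On the zero space \<open>m\<close> is \<open>1 / 0 = 0\<close>, and every operator is \<open>0\<close>.\<close>
    case True
    have "rinner y z = 0" for y z :: 'a using rinner_zero_left[of z] by (simp only: True[rule_format, of y])
    then show "selfadjoint ((ln N - ln (N - m)) *\<^sub>R (id_blinfun :: 'a \<Rightarrow>\<^sub>L 'a)) \<and> selfadjoint (op_log A - op_log B)
      \<and> (\<forall>x. rinner (((ln N - ln (N - m)) *\<^sub>R id_blinfun) x) x \<le> rinner ((op_log A - op_log B) x) x)"
      using selfadjoint_trivial_space[OF True[rule_format]] by simp
  next
    case False
    then obtain x0 :: 'a where x0: "x0 \<noteq> 0" by blast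
    define d where "d = 1 / norm (inverse_op B)"
    have "inverse_op B (B x0) = x0"
      using is_inverse_op_inverse_op[OF iB]
      by (auto simp: is_inverse_op_def dest: arg_cong[where f="\<lambda>f. blinfun_apply f x0"])
    then have "inverse_op B \<noteq> 0" using x0 by (auto simp: blinfun.zero_left)
    then have d: "0 < d" by (simp add: d_def)
    have Bd: "form_between d (N - m) B"
      using B positive_inverse_lower_bound[OF sB B0 is_inverse_op_inverse_op[OF iB]]
      by (auto simp: form_between_def d_def)
    have "d * (norm x0)\<^sup>2 \<le> (N - m) * (norm x0)\<^sup>2"
      using Bd by (auto simp: form_between_def intro: order_trans)
    then have mN: "0 < N - m" using x0 d by simp
    have m: "0 < m" using positive[OF x0] by simp
    have "selfadjoint (op_log A)" unfolding op_log_def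
      by (rule selfadjoint_fun_calc[OF A continuous_on_ln_interval[OF m]])
    moreover have "selfadjoint (op_log B)" unfolding op_log_def
      by (rule selfadjoint_fun_calc[OF Bd continuous_on_ln_interval[OF d]])
    moreover have "(ln N - ln (N - m)) * (norm x)\<^sup>2 \<le> rinner (op_log A x) x - rinner (op_log B x) x" for x
    proof -
      have "ereal (rinner (op_log B x) x)
          \<le> ereal (rinner (op_log A x) x - (ln N - ln (N - m)) * (norm x)\<^sup>2)"
        using op_log_le_log_form[OF Bd d] log_form_gap[OF A B m _ gap] mN by (meson order_trans diff_gt_0_iff_gt)
      then show ?thesis by simp
    qed
    ultimately show "selfadjoint ((ln N - ln (N - m)) *\<^sub>R (id_blinfun :: 'a \<Rightarrow>\<^sub>L 'a)) \<and> selfadjoint (op_log A - op_log B)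
      \<and> (\<forall>x. rinner (((ln N - ln (N - m)) *\<^sub>R id_blinfun) x) x \<le> rinner ((op_log A - op_log B) x) x)"
      by (auto intro: selfadjoint_diff selfadjoint_scaleR selfadjoint_id simp: rinner_simps)
  qed
  show ?thesis
    using powers invertible_logs logs unfolding N_def m_def rinner_def by blast
qed

end
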